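(* Let $E=\left\{\begin{pmatrix}a&b\\0&1\end{pmatrix}: a>0,\ b\in\mathbb{R}\right\}$ be the connected component of the identity of the group of affine mappings of the real line (with its usual Lie group topology). Then the twisted algebra $L^1(E,Ruc(E),T)$ is not symmetric, where $T$ is left translation on the right uniformly continuous functions $Ruc(E)$.
   Context: For a locally compact group $G$ fix a left Haar measure $dx$, with modular function $\Delta$ (so that $\int_G f(x^{-1})\Delta(x^{-1})\,dx=\int_G f(x)\,dx$). For $y\in G$ let $(T_yn)(z)=n(y^{-1}z)$. $Ruc(G)$ is the space of bounded right uniformly continuous functions, i.e. the subspace of $L^\infty(G)$ of those elements on which left translation acts norm continuously ($y\mapsto T_yn$ is continuous for $\|\cdot\|_\infty$); it consists of continuous functions and is a $C^*$-algebra. The twisted $L^1$-algebra $L^1(G,Ruc(G),T)$ is the Banach space of Bochner integrable functions $G\to Ruc(G)$ with norm $\int_G\|f(x)\|_\infty dx$, with product $(h\star f)(x)=\int_G T_y(h(xy))\,f(y^{-1})\,dy$ and involution $h^*(x)=\Delta(x^{-1})\,\overline{T_{x^{-1}}(h(x^{-1}))}$. A Banach $*$-algebra $B$ is symmetric if the spectrum in $B$ of $b^*b$ (computed in the unitization if $B$ has no identity) is contained in $[0,\infty)$ for all $b\in B$. *)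

theory Defs
  imports "HOL-Analysis.Analysis"
begin

text \<open>
  Groups are written additively, because the type class of (not necessarily commutative)
  topological groups of the library is \<^class>\<open>topological_group_add\<close>: the product
  \<open>x y\<close> is \<open>x + y\<close>, the inverse of \<open>x\<close> is \<open>- x\<close> and the identity is \<open>0\<close>. No commutativity
  is assumed.
\<close>

section \<open>The Bochner integral in an arbitrary normed space\<close>

text \<open>
  The integral of the library is restricted to second countable target spaces, which excludes
  the right uniformly continuous functions on a non-compact group. Simple functions and their
  integrals are those of the library. As the approximation is required almost everywhere, the
  notions below only depend on \<open>f\<close> up to null sets; \<open>nn_integral\<close> is insensitive to null
  sets also when its integrand is not Borel measurable.
\<close>

definition has_strong_integral ::
    "'a measure \<Rightarrow> ('a \<Rightarrow> 'b::real_normed_vector) \<Rightarrow> 'b \<Rightarrow> bool" where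
  "has_strong_integral M f I \<longleftrightarrow>
    (\<exists>s :: nat \<Rightarrow> 'a \<Rightarrow> 'b.
      (\<forall>i. Bochner_Integration.simple_bochner_integrable M (s i)) \<and>
      (AE x in M. (\<lambda>i. s i x) \<longlonglongrightarrow> f x) \<and>
      (\<lambda>i. \<integral>\<^sup>+x. ennreal (norm (f x - s i x)) \<partial>M) \<longlonglongrightarrow> 0 \<and>
      (\<lambda>i. Bochner_Integration.simple_bochner_integral M (s i)) \<longlonglongrightarrow> I)"

definition strongly_integrable :: "'a measure \<Rightarrow> ('a \<Rightarrow> 'b::real_normed_vector) \<Rightarrow> bool" where
  "strongly_integrable M f \<longleftrightarrow> (\<exists>I. has_strong_integral M f I)"

definition strong_integral :: "'a measure \<Rightarrow> ('a \<Rightarrow> 'b::real_normed_vector) \<Rightarrow> 'b" where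
  "strong_integral M f =
    (if strongly_integrable M f then THE I. has_strong_integral M f I else 0)"


section \<open>Haar measure and modular function\<close>

definition left_haar_measure :: "'g::{topological_group_add, t2_space} measure \<Rightarrow> bool" where
  "left_haar_measure \<mu> \<longleftrightarrow>
    sets \<mu> = sets borel \<and>
    emeasure \<mu> UNIV \<noteq> 0 \<and>
    (\<forall>K. compact K \<longrightarrow> emeasure \<mu> K < \<infinity>) \<and>
    (\<forall>A \<in> sets borel. emeasure \<mu> A = (INF U \<in> {U. open U \<and> A \<subseteq> U}. emeasure \<mu> U)) \<and>
    (\<forall>U. open U \<longrightarrow> emeasure \<mu> U = (SUP K \<in> {K. compact K \<and> K \<subseteq> U}. emeasure \<mu> K)) \<and>
    (\<forall>x. \<forall>A \<in> sets borel. emeasure \<mu> ((\<lambda>y. x + y) ` A) = emeasure \<mu> A)"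

text \<open>
  With the convention \<open>\<mu> (A x) = \<Delta> x \<cdot> \<mu> A\<close> one has
  \<open>\<integral> f (x\<inverse>) \<Delta> (x\<inverse>) dx = \<integral> f x dx\<close>.
\<close>

definition modular_function ::
    "'g::{topological_group_add, t2_space} measure \<Rightarrow> 'g \<Rightarrow> real" where
  "modular_function \<mu> x =
    (THE c. 0 < c \<and>
      (\<forall>A \<in> sets borel. emeasure \<mu> ((\<lambda>y. y + x) ` A) = ennreal c * emeasure \<mu> A))"


section \<open>Right uniformly continuous functions\<close>

context
  includes bcontfun.lifting
begin

lift_definition translate_bcontfun ::
    "'g::topological_group_add \<Rightarrow> ('g \<Rightarrow>\<^sub>C complex) \<Rightarrow> ('g \<Rightarrow>\<^sub>C complex)"
  is "\<lambda>y n z. n (- y + z)"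
proof -
  fix y :: 'g and n :: "'g \<Rightarrow> complex"
  assume "n \<in> bcontfun"
  then have n: "continuous_on UNIV n" "bounded (range n)"
    by (auto simp: bcontfun_def)
  have "continuous_on UNIV (\<lambda>z. n (- y + z))"
    by (rule continuous_on_compose2[OF n(1)]) (auto intro!: continuous_intros)
  moreover have "bounded (range (\<lambda>z. n (- y + z)))"
    by (rule bounded_subset[OF n(2)]) auto
  ultimately show "(\<lambda>z. n (- y + z)) \<in> bcontfun"
    by (simp add: bcontfun_def)
qed

lift_definition times_bcontfun ::
    "('g::topological_space \<Rightarrow>\<^sub>C complex) \<Rightarrow> ('g \<Rightarrow>\<^sub>C complex) \<Rightarrow> ('g \<Rightarrow>\<^sub>C complex)"
  is "\<lambda>f g z. f z * g z"
proof -
  fix f g :: "'g \<Rightarrow> complex"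
  assume "f \<in> bcontfun" "g \<in> bcontfun"
  then have fg: "continuous_on UNIV f" "bounded (range f)"
      "continuous_on UNIV g" "bounded (range g)"
    by (auto simp: bcontfun_def)
  obtain a b where "\<And>z. norm (f z) \<le> a" "\<And>z. norm (g z) \<le> b"
    using fg(2,4) by (auto simp: bounded_iff)
  then have "norm (f z * g z) \<le> a * b" for z
    by (simp add: norm_mult mult_mono' norm_ge_zero)
  then show "(\<lambda>z. f z * g z) \<in> bcontfun"
    by (intro bcontfun_normI) (auto intro!: continuous_intros fg)
qed

lift_definition cnj_bcontfun ::
    "('g::topological_space \<Rightarrow>\<^sub>C complex) \<Rightarrow> ('g \<Rightarrow>\<^sub>C complex)"
  is "\<lambda>f z. cnj (f z)"
proof -
  fix f :: "'g \<Rightarrow> complex"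
  assume "f \<in> bcontfun"
  then have f: "continuous_on UNIV f" "bounded (range f)"
    by (auto simp: bcontfun_def)
  obtain a where "\<And>z. norm (f z) \<le> a"
    using f(2) by (auto simp: bounded_iff)
  then show "(\<lambda>z. cnj (f z)) \<in> bcontfun"
    by (intro bcontfun_normI[where b = a]) (auto intro!: continuous_intros f)
qed

end

lemmas bcontfun_apply [simp] =
  translate_bcontfun.rep_eq times_bcontfun.rep_eq cnj_bcontfun.rep_eq

lemma bounded_bilinear_times_bcontfun: "bounded_bilinear times_bcontfun"
proof (standard, goal_cases)
  case 5
  have "norm (times_bcontfun f g) \<le> norm f * norm g * 1" for f g :: "'a \<Rightarrow>\<^sub>C complex"
    by (rule norm_bound) (simp add: norm_mult mult_mono norm_bounded)
  then show ?case by blast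
qed (auto intro!: bcontfun_eqI simp: algebra_simps)

lemma bounded_linear_cnj_bcontfun: "bounded_linear cnj_bcontfun"
proof (rule bounded_linear_intro[where K = 1])
  show "norm (cnj_bcontfun f) \<le> norm f * 1" for f :: "'a \<Rightarrow>\<^sub>C complex"
    by (rule norm_bound) (simp add: norm_bounded)
qed (auto intro!: bcontfun_eqI)

lemma translate_bcontfun_algebra:
  "translate_bcontfun y 0 = 0"
  "translate_bcontfun y (f + g) = translate_bcontfun y f + translate_bcontfun y g"
  "translate_bcontfun y (f - g) = translate_bcontfun y f - translate_bcontfun y g"
  "translate_bcontfun y (- f) = - translate_bcontfun y f"
  "translate_bcontfun y (r *\<^sub>R f) = r *\<^sub>R translate_bcontfun y f"
  "translate_bcontfun y (times_bcontfun f g) =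
     times_bcontfun (translate_bcontfun y f) (translate_bcontfun y g)"
  "translate_bcontfun y (cnj_bcontfun f) = cnj_bcontfun (translate_bcontfun y f)"
  "translate_bcontfun y (const_bcontfun c) = const_bcontfun c"
  "translate_bcontfun y (translate_bcontfun x f) = translate_bcontfun (y + x) f"
  by (auto intro!: bcontfun_eqI simp: minus_add simp flip: add.assoc)

text \<open>
  The elements of \<open>L\<^sup>\<infinity>\<close> on which translation is norm continuous have continuous
  representatives, and for bounded continuous functions the \<open>L\<^sup>\<infinity>\<close> norm is the supremum norm,
  which is the norm of \<^typ>\<open>'g \<Rightarrow>\<^sub>C complex\<close>.
\<close>

typedef (overloaded) 'g ruc =
  "{f :: 'g::topological_group_add \<Rightarrow>\<^sub>C complex. continuous_on UNIV (\<lambda>y. translate_bcontfun y f)}"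
  morphisms bcontfun_of_ruc Abs_ruc
  by (rule exI[of _ 0]) (simp add: translate_bcontfun_algebra)

setup_lifting type_definition_ruc

instantiation ruc :: (topological_group_add) real_vector
begin

lift_definition zero_ruc :: "'a ruc" is 0
  by (simp add: translate_bcontfun_algebra)

lift_definition plus_ruc :: "'a ruc \<Rightarrow> 'a ruc \<Rightarrow> 'a ruc" is "(+)"
  by (simp add: translate_bcontfun_algebra continuous_on_add)

lift_definition minus_ruc :: "'a ruc \<Rightarrow> 'a ruc \<Rightarrow> 'a ruc" is "(-)"
  by (simp add: translate_bcontfun_algebra continuous_on_diff)

lift_definition uminus_ruc :: "'a ruc \<Rightarrow> 'a ruc" is uminus
  by (simp add: translate_bcontfun_algebra continuous_on_minus)

lift_definition scaleR_ruc :: "real \<Rightarrow> 'a ruc \<Rightarrow> 'a ruc" is scaleR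
  by (simp add: translate_bcontfun_algebra continuous_intros)

instance
  by (standard; transfer; simp add: algebra_simps)

end

instantiation ruc :: (topological_group_add) real_normed_algebra
begin

lift_definition times_ruc :: "'a ruc \<Rightarrow> 'a ruc \<Rightarrow> 'a ruc" is times_bcontfun
  by (simp add: translate_bcontfun_algebra
      bounded_bilinear.continuous_on[OF bounded_bilinear_times_bcontfun])

lift_definition norm_ruc :: "'a ruc \<Rightarrow> real" is norm .

lift_definition dist_ruc :: "'a ruc \<Rightarrow> 'a ruc \<Rightarrow> real" is dist .

definition sgn_ruc :: "'a ruc \<Rightarrow> 'a ruc" where
  "sgn_ruc f = f /\<^sub>R norm f"

definition uniformity_ruc :: "('a ruc \<times> 'a ruc) filter" where
  "uniformity_ruc = (INF e\<in>{0 <..}. principal {(x, y). dist x y < e})"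

definition open_ruc :: "'a ruc set \<Rightarrow> bool" where
  "open_ruc S = (\<forall>x\<in>S. \<forall>\<^sub>F (x', y) in uniformity. x' = x \<longrightarrow> y \<in> S)"

instance
proof
  fix f g :: "'a ruc"
  show "norm (f + g) \<le> norm f + norm g"
    by transfer (rule norm_triangle_ineq)
  show "norm (f * g) \<le> norm f * norm g"
    by transfer (rule norm_bound, simp add: norm_mult mult_mono norm_bounded)
  show "dist f g = norm (f - g)"
    by transfer (rule dist_norm)
  show "norm f = 0 \<longleftrightarrow> f = 0"
    by transfer simp
  fix r :: real and h :: "'a ruc"
  show "norm (r *\<^sub>R f) = \<bar>r\<bar> * norm f"
    by transfer simp
  show "f * g * h = f * (g * h)" "(f + g) * h = f * h + g * h" "h * (f + g) = h * f + h * g"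
      "r *\<^sub>R f * g = r *\<^sub>R (f * g)" "f * r *\<^sub>R g = r *\<^sub>R (f * g)"
    by (transfer, auto intro!: bcontfun_eqI simp: algebra_simps)+
qed (rule sgn_ruc_def uniformity_ruc_def open_ruc_def)+

end

lift_definition cscale_ruc :: "complex \<Rightarrow> 'g::topological_group_add ruc \<Rightarrow> 'g ruc"
  is "\<lambda>c f. times_bcontfun (const_bcontfun c) f"
  by (simp add: translate_bcontfun_algebra
      bounded_bilinear.continuous_on[OF bounded_bilinear_times_bcontfun])

lift_definition cnj_ruc :: "'g::topological_group_add ruc \<Rightarrow> 'g ruc" is cnj_bcontfun
  by (simp add: translate_bcontfun_algebra
      bounded_linear.continuous_on[OF bounded_linear_cnj_bcontfun])

lift_definition translate_ruc :: "'g::topological_group_add \<Rightarrow> 'g ruc \<Rightarrow> 'g ruc"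
  is translate_bcontfun
  unfolding translate_bcontfun_algebra
  by (erule continuous_on_compose2) (auto intro!: continuous_intros)


section \<open>Symmetric Banach \<open>*\<close>-algebras\<close>

record 'b star_algebra =
  sa_carrier :: "'b set"
  sa_zero :: 'b
  sa_add :: "'b \<Rightarrow> 'b \<Rightarrow> 'b"
  sa_scale :: "complex \<Rightarrow> 'b \<Rightarrow> 'b"
  sa_mult :: "'b \<Rightarrow> 'b \<Rightarrow> 'b"
  sa_star :: "'b \<Rightarrow> 'b"
  sa_norm :: "'b \<Rightarrow> real"

definition is_sa_identity :: "'b star_algebra \<Rightarrow> 'b \<Rightarrow> bool" where
  "is_sa_identity B e \<longleftrightarrow>
    e \<in> sa_carrier B \<and> (\<forall>b \<in> sa_carrier B. sa_mult B e b = b \<and> sa_mult B b e = b)"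

definition sa_identity :: "'b star_algebra \<Rightarrow> 'b" where
  "sa_identity B = (THE e. is_sa_identity B e)"

definition sa_invertible :: "'b star_algebra \<Rightarrow> 'b \<Rightarrow> bool" where
  "sa_invertible B b \<longleftrightarrow>
    (\<exists>c \<in> sa_carrier B. sa_mult B b c = sa_identity B \<and> sa_mult B c b = sa_identity B)"

definition unital_spectrum :: "'b star_algebra \<Rightarrow> 'b \<Rightarrow> complex set" where
  "unital_spectrum B b =
    {l. \<not> sa_invertible B (sa_add B b (sa_scale B (- l) (sa_identity B)))}"

definition unitization :: "'b star_algebra \<Rightarrow> (complex \<times> 'b) star_algebra" where
  "unitization B =
    \<lparr> sa_carrier = UNIV \<times> sa_carrier B,
      sa_zero = (0, sa_zero B),
      sa_add = (\<lambda>(k, a) (l, b). (k + l, sa_add B a b)),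
      sa_scale = (\<lambda>c (k, a). (c * k, sa_scale B c a)),
      sa_mult = (\<lambda>(k, a) (l, b).
        (k * l, sa_add B (sa_add B (sa_scale B k b) (sa_scale B l a)) (sa_mult B a b))),
      sa_star = (\<lambda>(k, a). (cnj k, sa_star B a)),
      sa_norm = (\<lambda>(k, a). cmod k + sa_norm B a) \<rparr>"

definition spectrum :: "'b star_algebra \<Rightarrow> 'b \<Rightarrow> complex set" where
  "spectrum B b =
    (if \<exists>e. is_sa_identity B e then unital_spectrum B b
     else unital_spectrum (unitization B) (0, b))"

definition symmetric_star_algebra :: "'b star_algebra \<Rightarrow> bool" where
  "symmetric_star_algebra B \<longleftrightarrow>
    (\<forall>b \<in> sa_carrier B. spectrum B (sa_mult B (sa_star B b) b) \<subseteq> complex_of_real ` {0..})"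


section \<open>The twisted \<open>L\<^sup>1\<close>-algebra\<close>

definition twisted_conv ::
    "'g::{topological_group_add, t2_space} measure \<Rightarrow> ('g \<Rightarrow> 'g ruc) \<Rightarrow> ('g \<Rightarrow> 'g ruc) \<Rightarrow> 'g \<Rightarrow> 'g ruc" where
  "twisted_conv \<mu> h f x = strong_integral \<mu> (\<lambda>y. translate_ruc y (h (x + y)) * f (- y))"

definition twisted_star ::
    "'g::{topological_group_add, t2_space} measure \<Rightarrow> ('g \<Rightarrow> 'g ruc) \<Rightarrow> 'g \<Rightarrow> 'g ruc" where
  "twisted_star \<mu> h x = modular_function \<mu> (- x) *\<^sub>R cnj_ruc (translate_ruc (- x) (h (- x)))"

definition ae_class :: "'a measure \<Rightarrow> ('a \<Rightarrow> 'b) \<Rightarrow> ('a \<Rightarrow> 'b) set" where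
  "ae_class \<mu> f = {g. AE x in \<mu>. g x = f x}"

definition representative :: "('a \<Rightarrow> 'b) set \<Rightarrow> ('a \<Rightarrow> 'b)" where
  "representative F = (SOME f. f \<in> F)"

text \<open>
  The convolution of two integrable functions is given by a convergent Bochner integral for
  almost every \<open>x\<close>; at the remaining points \<open>twisted_conv\<close> takes the value \<open>0\<close>. All operations
  respect equality almost everywhere, so the choice of representatives is immaterial.
  The norm is taken as an \<open>nn_integral\<close> because a representative need not be Borel measurable
  on a null set.
\<close>

definition twisted_L1 ::
    "'g::{topological_group_add, t2_space} measure \<Rightarrow> ('g \<Rightarrow> 'g ruc) set star_algebra" where
  "twisted_L1 \<mu> =
    \<lparr> sa_carrier = ae_class \<mu> ` {f. strongly_integrable \<mu> f},
      sa_zero = ae_class \<mu> (\<lambda>x. 0),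
      sa_add = (\<lambda>F G. ae_class \<mu> (\<lambda>x. representative F x + representative G x)),
      sa_scale = (\<lambda>c F. ae_class \<mu> (\<lambda>x. cscale_ruc c (representative F x))),
      sa_mult = (\<lambda>F G. ae_class \<mu> (twisted_conv \<mu> (representative F) (representative G))),
      sa_star = (\<lambda>F. ae_class \<mu> (twisted_star \<mu> (representative F))),
      sa_norm = (\<lambda>F. enn2real (\<integral>\<^sup>+x. ennreal (norm (representative F x)) \<partial>\<mu>)) \<rparr>"


section \<open>The group \<open>E\<close>\<close>

typedef affine_group = "{vector [vector [a, b], vector [0, 1]] :: real^2^2 |a b. a > 0}"
  morphisms matrix_of Abs_affine_group
  by (rule exI[of _ "vector [vector [1, 0], vector [0, 1]]"]) auto

setup_lifting type_definition_affine_group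

lemma affine_mult:
  "(vector [vector [a, b], vector [0, 1]] :: real^2^2) ** vector [vector [c, d], vector [0, 1]] =
    (vector [vector [a * c, a * d + b], vector [0, 1]] :: real^2^2)"
  by (simp add: vec_eq_iff forall_2 matrix_matrix_mult_def sum_2)

lemma affine_one: "(vector [vector [1, 0], vector [0, 1]] :: real^2^2) = mat 1"
  by (simp add: vec_eq_iff forall_2 mat_def)

lemma affine_inverse:
  assumes "a > 0"
  shows "matrix_inv (vector [vector [a, b], vector [0, 1]] :: real^2^2) =
    vector [vector [1 / a, - b / a], vector [0, 1]]" (is "matrix_inv ?A = ?B")
proof -
  have *: "?A ** ?B = mat 1" "?B ** ?A = mat 1"
    using assms by (simp_all add: affine_mult flip: affine_one)
  then have "invertible ?A"
    unfolding invertible_def by blast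
  then have "?A ** matrix_inv ?A = mat 1"
    unfolding invertible_def matrix_inv_def by (rule someI2_ex) blast
  then have "?B ** (?A ** matrix_inv ?A) = ?B"
    by simp
  then show ?thesis
    unfolding matrix_mul_assoc * by simp
qed

instantiation affine_group :: group_add
begin

lift_definition zero_affine_group :: affine_group is "mat 1"
  by (auto simp flip: affine_one intro!: exI)

lift_definition plus_affine_group :: "affine_group \<Rightarrow> affine_group \<Rightarrow> affine_group" is "(**)"
  unfolding mem_Collect_eq
  by (elim exE conjE, intro exI conjI) (simp only: affine_mult, rule mult_pos_pos)

lift_definition uminus_affine_group :: "affine_group \<Rightarrow> affine_group" is matrix_inv
  unfolding mem_Collect_eq
  by (elim exE conjE, intro exI conjI) (simp only: affine_inverse, simp)

definition minus_affine_group :: "affine_group \<Rightarrow> affine_group \<Rightarrow> affine_group" where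
  "minus_affine_group x y = x + - y"

instance
proof
  fix x y z :: affine_group
  show "x + y + z = x + (y + z)"
    by transfer (simp add: matrix_mul_assoc)
  show "0 + x = x" "x + 0 = x"
    by (transfer, simp)+
  show "- x + x = 0"
  proof -
    obtain a b where "a > 0" and A: "matrix_of x = vector [vector [a, b], vector [0, 1]]"
      using matrix_of[of x] unfolding mem_Collect_eq by (elim exE conjE)
    from \<open>a > 0\<close> have "matrix_of (- x + x) = matrix_of 0"
      unfolding plus_affine_group.rep_eq uminus_affine_group.rep_eq zero_affine_group.rep_eq A
        affine_inverse[OF \<open>a > 0\<close>] affine_mult affine_one[symmetric] by simp
    then show ?thesis
      by (simp only: matrix_of_inject)
  qed
  show "x + - y = x - y"
    by (simp add: minus_affine_group_def)
qed

end

instantiation affine_group :: t2_space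
begin

definition open_affine_group :: "affine_group set \<Rightarrow> bool" where
  "open_affine_group U \<longleftrightarrow> (\<exists>V. open V \<and> U = matrix_of -` V)"

instance
proof
  show "open (UNIV :: affine_group set)"
    unfolding open_affine_group_def by (rule exI[of _ UNIV]) simp
  show "open (S \<inter> T)" if "open S" "open T" for S T :: "affine_group set"
    using that unfolding open_affine_group_def by (metis open_Int vimage_Int)
  show "open (\<Union>K)" if K: "\<forall>S\<in>K. open S" for K :: "affine_group set set"
  proof -
    obtain V where V: "\<And>S. S \<in> K \<Longrightarrow> open (V S) \<and> S = matrix_of -` V S"
      using K unfolding open_affine_group_def by metis
    then have "\<Union>K = matrix_of -` (\<Union>S\<in>K. V S)" by blast
    moreover have "open (\<Union>S\<in>K. V S)"
      using V by (intro open_UN) simp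
    ultimately show ?thesis
      unfolding open_affine_group_def by (intro exI conjI)
  qed
  fix x y :: affine_group
  assume "x \<noteq> y"
  then have "matrix_of x \<noteq> matrix_of y"
    by (simp add: matrix_of_inject)
  then obtain U V where "open U" "open V" "matrix_of x \<in> U" "matrix_of y \<in> V" "U \<inter> V = {}"
    by (meson hausdorff)
  then show "\<exists>U V. open U \<and> open V \<and> x \<in> U \<and> y \<in> V \<and> U \<inter> V = {}"
    unfolding open_affine_group_def
    by (intro exI[of _ "matrix_of -` U"] exI[of _ "matrix_of -` V"]) auto
qed

end

lemma tendsto_affine_group_iff:
  "(f \<longlongrightarrow> l) F \<longleftrightarrow> ((\<lambda>x. matrix_of (f x)) \<longlongrightarrow> matrix_of l) F"
  by (auto simp: tendsto_def open_affine_group_def)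

instance affine_group :: topological_group_add
proof
  fix a b :: affine_group
  have lim: "((\<lambda>x. matrix_of x) \<longlongrightarrow> matrix_of a) (nhds a)" for a
    using tendsto_affine_group_iff[of "\<lambda>x. x" a "nhds a"] by (simp add: filterlim_ident)
  show "((\<lambda>x. fst x + snd x) \<longlongrightarrow> a + b) (nhds a \<times>\<^sub>F nhds b)"
    unfolding tendsto_affine_group_iff plus_affine_group.rep_eq matrix_matrix_mult_def
    by (intro tendsto_vec_lambda tendsto_sum tendsto_mult tendsto_vec_nth
        filterlim_compose[OF lim] filterlim_fst filterlim_snd)
  have inv: "matrix_of (- x) =
      vector [vector [1 / matrix_of x $ 1 $ 1, - matrix_of x $ 1 $ 2 / matrix_of x $ 1 $ 1],
        vector [0, 1]]"
    and pos: "matrix_of x $ 1 $ 1 > 0" for x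
    by (transfer, auto simp: affine_inverse)+
  have 11: "((\<lambda>x. matrix_of x $ 1 $ 1) \<longlongrightarrow> matrix_of a $ 1 $ 1) (nhds a)"
    and 12: "((\<lambda>x. matrix_of x $ 1 $ 2) \<longlongrightarrow> matrix_of a $ 1 $ 2) (nhds a)"
    by (intro tendsto_vec_nth lim)+
  show "(uminus \<longlongrightarrow> - a) (nhds a)"
    unfolding tendsto_affine_group_iff
  proof (intro vec_tendstoI)
    fix i j :: 2
    show "((\<lambda>x. matrix_of (- x) $ i $ j) \<longlongrightarrow> matrix_of (- a) $ i $ j) (nhds a)"
      using exhaust_2[of i] exhaust_2[of j] pos[of a]
      by (auto simp: inv intro!: tendsto_divide tendsto_minus 11 12)
  qed
qed

end

theory Submission
  imports Defs
begin

text \<open>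
  Write \<open>\<psi>\<close> for the tent function on \<open>{-1..1}\<close> and \<open>\<Psi>\<close> for the function \<open>z \<mapsto> \<psi> (shift z)\<close> on the group,
  where \<open>shift\<close> is the upper right matrix entry. Translation acts norm continuously on \<open>\<Psi>\<close>. To a
  bounded function \<open>p\<close> on the line with bounded support belongs the element
  \<open>k\<^sub>p x = p (log_scale x) \<cdot> \<Psi> \<cdot> T\<^bsub>-x\<^esub> \<Psi>\<close> of the twisted algebra (\<open>strip_kernel\<close>). Seen as a kernel
  that moves \<open>z\<close> to \<open>x + z\<close>, it is confined to the strip of points with shift in \<open>{-1<..<1}\<close> and only
  sees the scale of \<open>x\<close>: multiplication by the functions \<open>\<Psi>\<close> cuts the commutative group of
  dilations out of the affine group. Consequently these elements are closed under adjoints and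
  products (\<open>twisted_star_strip_kernel\<close>, \<open>twisted_conv_strip_kernels\<close>). The product corresponds to
  a weighted convolution of profiles, and the adjoint to \<open>p\<^sup>* s = exp s \<cdot> p (- s)\<close>, the exponential
  being the modular function at \<open>- x\<close>, for \<open>x\<close> of logarithmic scale \<open>s\<close>.

  The norm of strip kernels grows exponentially in one direction of the dilations, so that there
  are bounded multiplicative functionals on strip kernels that do not respect the involution. One
  of them is \<open>m p = \<integral> \<Psi>\<^sup>2 \<cdot> p (log_scale x) dx\<close> (\<open>strip_mean\<close>), a positive multiple of
  \<open>\<integral> exp (- s) p s ds\<close>, whereas \<open>m (p\<^sup>*)\<close> is the same multiple of \<open>\<integral> p s ds\<close>. For a suitable step
  function \<open>p\<close> these two numbers have opposite signs (\<open>strip_mean_step\<close>), and then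
  \<open>k\<^sub>p\<^sup>* \<star> k\<^sub>p = k\<^sub>q\<close> with \<open>m q = m (p\<^sup>*) \<cdot> m p < 0\<close>.

  It remains to see that \<open>m q\<close> belongs to the spectrum of \<open>k\<^sub>q\<close> in the whole algebra. This follows
  from the bounded functional \<open>L c = \<integral> \<Psi> x \<cdot> c x 0 dx\<close> (\<open>strip_functional\<close>), which satisfies
  \<open>L (k\<^sub>q \<star> c) = m q \<cdot> L c\<close> for all \<open>c\<close> (\<open>strip_functional_conv\<close>) and \<open>L k\<^sub>q = m q\<close>: extended
  by \<open>1\<close> on the identity of the unitization, it annihilates the right ideal generated by
  \<open>k\<^sub>q - m q\<close> (\<open>strip_mean_in_spectrum\<close>). The spectrum is that of the unitization, as the algebra has no
  identity (\<open>no_identity\<close>).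

  The preparations are the Bochner integral for strongly measurable functions into a Banach space
  and the uniqueness of Haar measure on the affine group (\<open>haar_unique\<close>), which determines the
  modular function.
\<close>

section \<open>Strong measurability and the Bochner integral\<close>

text \<open>
  In a non-separable space sums and products of Borel functions need not be Borel. Pointwise
  limits of simple functions are stable under all continuous operations.
\<close>

definition strongly_measurable :: "'a measure \<Rightarrow> ('a \<Rightarrow> 'b::topological_space) \<Rightarrow> bool" where
  "strongly_measurable M f \<longleftrightarrow>
    (\<exists>s :: nat \<Rightarrow> 'a \<Rightarrow> 'b. (\<forall>i. simple_function M (s i)) \<and>
      (\<forall>x \<in> space M. (\<lambda>i. s i x) \<longlonglongrightarrow> f x))"

lemma strongly_measurable_continuous:
  assumes "strongly_measurable M f" "continuous_on UNIV g"
  shows "strongly_measurable M (\<lambda>x. g (f x))"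
proof -
  obtain s where s: "\<And>i. simple_function M (s i)"
      "\<And>x. x \<in> space M \<Longrightarrow> (\<lambda>i. s i x) \<longlonglongrightarrow> f x"
    using assms(1) unfolding strongly_measurable_def by blast
  show ?thesis
    unfolding strongly_measurable_def
  proof (intro exI[of _ "\<lambda>i x. g (s i x)"] conjI allI ballI)
    show "simple_function M (\<lambda>x. g (s i x))" for i
      by (rule simple_function_compose1[OF s(1)])
    show "(\<lambda>i. g (s i x)) \<longlonglongrightarrow> g (f x)" if "x \<in> space M" for x
      by (rule continuous_on_tendsto_compose[OF assms(2) s(2)[OF that]]) auto
  qed
qed

lemma strongly_measurable_Pair:
  assumes "strongly_measurable M f" "strongly_measurable M g"
  shows "strongly_measurable M (\<lambda>x. (f x, g x))"
proof -
  obtain s where s: "\<And>i. simple_function M (s i)"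
      "\<And>x. x \<in> space M \<Longrightarrow> (\<lambda>i. s i x) \<longlonglongrightarrow> f x"
    using assms(1) unfolding strongly_measurable_def by blast
  obtain t where t: "\<And>i. simple_function M (t i)"
      "\<And>x. x \<in> space M \<Longrightarrow> (\<lambda>i. t i x) \<longlonglongrightarrow> g x"
    using assms(2) unfolding strongly_measurable_def by blast
  show ?thesis
    unfolding strongly_measurable_def
  proof (intro exI[of _ "\<lambda>i x. (s i x, t i x)"] conjI allI ballI)
    show "simple_function M (\<lambda>x. (s i x, t i x))" for i
      by (rule simple_function_Pair[OF s(1) t(1)])
    show "(\<lambda>i. (s i x, t i x)) \<longlonglongrightarrow> (f x, g x)" if "x \<in> space M" for x
      by (rule tendsto_Pair[OF s(2)[OF that] t(2)[OF that]])
  qed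
qed

lemma strongly_measurable_bilinear:
  assumes "strongly_measurable M f" "strongly_measurable M g" "bounded_bilinear b"
  shows "strongly_measurable M (\<lambda>x. b (f x) (g x))"
proof -
  have "continuous_on UNIV (\<lambda>p. b (fst p) (snd p))"
    by (intro bounded_bilinear.continuous_on[OF assms(3)] continuous_intros)
  from strongly_measurable_continuous[OF strongly_measurable_Pair[OF assms(1,2)] this]
  show ?thesis by simp
qed

lemmas strongly_measurable_mult = strongly_measurable_bilinear[OF _ _ bounded_bilinear_mult]

lemmas strongly_measurable_scaleR = strongly_measurable_bilinear[OF _ _ bounded_bilinear_scaleR]

lemma strongly_measurable_compose:
  assumes "strongly_measurable N f" "T \<in> measurable M N"
  shows "strongly_measurable M (\<lambda>x. f (T x))"
proof -
  obtain s where s: "\<And>i. simple_function N (s i)"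
      "\<And>x. x \<in> space N \<Longrightarrow> (\<lambda>i. s i x) \<longlonglongrightarrow> f x"
    using assms(1) unfolding strongly_measurable_def by blast
  show ?thesis
    unfolding strongly_measurable_def
  proof (intro exI[of _ "\<lambda>i x. s i (T x)"] conjI allI ballI)
    show "simple_function M (\<lambda>x. s i (T x))" for i
      by (rule simple_function_comp[OF assms(2) s(1)])
    show "(\<lambda>i. s i (T x)) \<longlonglongrightarrow> f (T x)" if "x \<in> space M" for x
      by (rule s(2)[OF measurable_space[OF assms(2) that]])
  qed
qed

lemma strongly_measurable_borel:
  fixes f :: "'a \<Rightarrow> 'b::{metric_space, second_countable_topology}"
  assumes "f \<in> borel_measurable M"
  shows "strongly_measurable M f"
  using borel_measurable_implies_sequence_metric[OF assms] unfolding strongly_measurable_def by blast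

lemma borel_measurable_strongly_measurable:
  fixes f :: "'a \<Rightarrow> 'b::metric_space"
  assumes "strongly_measurable M f"
  shows "f \<in> borel_measurable M"
proof -
  obtain s where s: "\<And>i. simple_function M (s i)"
      "\<And>x. x \<in> space M \<Longrightarrow> (\<lambda>i. s i x) \<longlonglongrightarrow> f x"
    using assms(1) unfolding strongly_measurable_def by blast
  show ?thesis
    by (rule borel_measurable_LIMSEQ_metric[OF borel_measurable_simple_function[OF s(1)] s(2)])
qed

lemma borel_measurable_norm_strongly:
  fixes f :: "'a \<Rightarrow> 'b::real_normed_vector"
  assumes "strongly_measurable M f"
  shows "(\<lambda>x. norm (f x)) \<in> borel_measurable M"
  by (intro borel_measurable_strongly_measurable strongly_measurable_continuous[OF assms]
      continuous_intros)

lemma borel_measurable_norm_diff_strongly: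
  fixes f :: "'a \<Rightarrow> 'b::real_normed_vector"
  assumes "strongly_measurable M f" "strongly_measurable M g"
  shows "(\<lambda>x. norm (f x - g x)) \<in> borel_measurable M"
proof -
  have "continuous_on UNIV (\<lambda>p::'b \<times> 'b. norm (fst p - snd p))"
    by (intro continuous_intros)
  from strongly_measurable_continuous[OF strongly_measurable_Pair[OF assms] this]
  show ?thesis by (simp add: borel_measurable_strongly_measurable)
qed

lemma strongly_measurable_simple:
  "simple_function M s \<Longrightarrow> strongly_measurable M s"
  unfolding strongly_measurable_def by (rule exI[of _ "\<lambda>i. s"]) auto

lemma simple_bochner_integral_dist_le:
  fixes f :: "'a \<Rightarrow> 'b::real_normed_vector"
  assumes f: "strongly_measurable M f"
    and s: "Bochner_Integration.simple_bochner_integrable M s"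
    and t: "Bochner_Integration.simple_bochner_integrable M t"
  shows "ennreal (dist (Bochner_Integration.simple_bochner_integral M s)
      (Bochner_Integration.simple_bochner_integral M t)) \<le>
    (\<integral>\<^sup>+x. ennreal (norm (f x - s x)) \<partial>M) + (\<integral>\<^sup>+x. ennreal (norm (f x - t x)) \<partial>M)"
proof -
  have sm: "strongly_measurable M s" "strongly_measurable M t"
    using s t by (auto intro: strongly_measurable_simple elim: simple_bochner_integrable.cases)
  note [measurable] = borel_measurable_norm_diff_strongly[OF f sm(1)]
    borel_measurable_norm_diff_strongly[OF f sm(2)]
  have "ennreal (dist (Bochner_Integration.simple_bochner_integral M s)
      (Bochner_Integration.simple_bochner_integral M t)) =
      norm (Bochner_Integration.simple_bochner_integral M (\<lambda>x. s x - t x))"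
    using s t by (subst simple_bochner_integral_diff) (auto simp: dist_norm)
  also have "\<dots> \<le> Bochner_Integration.simple_bochner_integral M (\<lambda>x. norm (s x - t x))"
    using simple_bochner_integrable_compose2[of "(-)" M "s" "t"] s t
    by (auto intro!: simple_bochner_integral_norm_bound ennreal_leI)
  also have "\<dots> = (\<integral>\<^sup>+x. ennreal (norm (s x - t x)) \<partial>M)"
    using simple_bochner_integrable_compose2[of "\<lambda>x y. norm (x - y)" M "s" "t"] s t
    by (auto intro!: simple_bochner_integral_eq_nn_integral)
  also have "\<dots> \<le> (\<integral>\<^sup>+x. ennreal (norm (f x - s x)) + ennreal (norm (f x - t x)) \<partial>M)"
  proof (intro nn_integral_mono)
    fix x
    have "norm (s x - t x) \<le> norm (f x - s x) + norm (f x - t x)"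
      by (metis dual_order.refl norm_diff_triangle_le norm_minus_commute)
    then show "ennreal (norm (s x - t x)) \<le> ennreal (norm (f x - s x)) + ennreal (norm (f x - t x))"
      by (simp flip: ennreal_plus)
  qed
  also have "\<dots> = (\<integral>\<^sup>+x. ennreal (norm (f x - s x)) \<partial>M) + (\<integral>\<^sup>+x. ennreal (norm (f x - t x)) \<partial>M)"
    by (rule nn_integral_add) auto
  finally show ?thesis .
qed

lemma has_strong_integral_cong_AE:
  fixes f g :: "'a \<Rightarrow> 'b::real_normed_vector"
  assumes "AE x in M. f x = g x"
  shows "has_strong_integral M f I \<longleftrightarrow> has_strong_integral M g I"
proof -
  have *: "has_strong_integral M g I" if f: "has_strong_integral M f I" and eq: "AE x in M. f x = g x"
    for f g :: "'a \<Rightarrow> 'b"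
  proof -
    obtain s where s: "\<And>i. Bochner_Integration.simple_bochner_integrable M (s i)"
      "AE x in M. (\<lambda>i. s i x) \<longlonglongrightarrow> f x"
      "(\<lambda>i. \<integral>\<^sup>+x. ennreal (norm (f x - s i x)) \<partial>M) \<longlonglongrightarrow> 0"
      "(\<lambda>i. Bochner_Integration.simple_bochner_integral M (s i)) \<longlonglongrightarrow> I"
      using f unfolding has_strong_integral_def by blast
    have "(\<integral>\<^sup>+x. ennreal (norm (g x - s i x)) \<partial>M) = (\<integral>\<^sup>+x. ennreal (norm (f x - s i x)) \<partial>M)" for i
      using eq by (intro nn_integral_cong_AE) auto
    moreover have "AE x in M. (\<lambda>i. s i x) \<longlonglongrightarrow> g x"
      using s(2) eq by eventually_elim simp
    ultimately show ?thesis
      unfolding has_strong_integral_def using s by (intro exI[of _ s]) simp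
  qed
  show ?thesis
    using *[of f g] *[of g f] assms by (auto simp: eq_commute)
qed

lemma strong_integral_cong_AE:
  "AE x in M. f x = g x \<Longrightarrow> strong_integral M f = strong_integral M g"
  unfolding strong_integral_def strongly_integrable_def
  using has_strong_integral_cong_AE[of f g M] by presburger

text \<open>
  Redefining \<open>f\<close> as \<open>0\<close> on the null set where its simple approximations do not converge makes it
  a limit of simple functions everywhere.
\<close>

lemma strongly_integrable_imp_strongly_measurable:
  assumes "strongly_integrable M f"
  obtains g where "strongly_measurable M g" "AE x in M. f x = g x"
    "(\<integral>\<^sup>+x. ennreal (norm (g x)) \<partial>M) < \<infinity>"
proof -
  obtain s I where s: "\<And>i. Bochner_Integration.simple_bochner_integrable M (s i)"
    "AE x in M. (\<lambda>i. s i x) \<longlonglongrightarrow> f x"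
    "(\<lambda>i. \<integral>\<^sup>+x. ennreal (norm (f x - s i x)) \<partial>M) \<longlonglongrightarrow> 0"
    using assms unfolding strongly_integrable_def has_strong_integral_def by blast
  obtain N where N: "N \<in> null_sets M" "{x \<in> space M. \<not> (\<lambda>i. s i x) \<longlonglongrightarrow> f x} \<subseteq> N"
    using s(2) by (auto simp: eventually_ae_filter)
  define g where "g x = (if x \<in> N then 0 else f x)" for x
  have sf: "simple_function M (s i)" for i
    using s(1)[of i] by (auto elim: simple_bochner_integrable.cases)
  have g: "strongly_measurable M g"
    unfolding strongly_measurable_def
  proof (intro exI[of _ "\<lambda>i x. if x \<in> N then 0 else s i x"] conjI allI ballI)
    fix i
    show "simple_function M (\<lambda>x. if x \<in> N then 0 else s i x)"
      using N(1) sf by (intro simple_function_If_set) auto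
  next
    fix x assume "x \<in> space M"
    then show "(\<lambda>i. if x \<in> N then 0 else s i x) \<longlonglongrightarrow> g x"
      using N(2) by (auto simp: g_def)
  qed
  have fg: "AE x in M. f x = g x"
    using AE_not_in[OF N(1)] by eventually_elim (simp add: g_def)
  have "\<exists>i. (\<integral>\<^sup>+x. ennreal (norm (f x - s i x)) \<partial>M) < 1"
    using order_tendstoD(2)[OF s(3), of 1] by (auto simp: eventually_sequentially)
  then obtain i where i: "(\<integral>\<^sup>+x. ennreal (norm (f x - s i x)) \<partial>M) < 1" by blast
  note [measurable] = borel_measurable_norm_diff_strongly[OF g strongly_measurable_simple[OF sf[of i]]]
    borel_measurable_norm_strongly[OF strongly_measurable_simple[OF sf[of i]]]
  have "(\<integral>\<^sup>+x. ennreal (norm (g x)) \<partial>M) \<le>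
      (\<integral>\<^sup>+x. ennreal (norm (g x - s i x)) + ennreal (norm (s i x)) \<partial>M)"
    by (intro nn_integral_mono)
      (simp add: norm_triangle_sub add.commute flip: ennreal_plus)
  also have "\<dots> = (\<integral>\<^sup>+x. ennreal (norm (g x - s i x)) \<partial>M) + (\<integral>\<^sup>+x. ennreal (norm (s i x)) \<partial>M)"
    by (rule nn_integral_add) auto
  also have "(\<integral>\<^sup>+x. ennreal (norm (g x - s i x)) \<partial>M) = (\<integral>\<^sup>+x. ennreal (norm (f x - s i x)) \<partial>M)"
    using fg by (intro nn_integral_cong_AE) auto
  also have "\<dots> + (\<integral>\<^sup>+x. ennreal (norm (s i x)) \<partial>M) < \<infinity>"
  proof -
    have "Bochner_Integration.simple_bochner_integrable M (\<lambda>x. norm (s i x))"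
      using simple_bochner_integrable_compose2[of "\<lambda>x y. norm x" M "s i" "s i"] s(1) by simp
    then have "(\<integral>\<^sup>+x. ennreal (norm (s i x)) \<partial>M) < \<infinity>"
      by (simp flip: simple_bochner_integral_eq_nn_integral)
    with i show ?thesis
      by (metis ennreal_add_less_top infinity_ennreal_def less_trans ennreal_one_less_top)
  qed
  finally show ?thesis
    using that g fg by blast
qed

text \<open>
  Replacing the values of the approximations of norm above \<open>2 \<cdot> norm (f x)\<close> by \<open>0\<close> does not disturb
  pointwise convergence, and makes dominated convergence applicable.
\<close>

lemma strongly_measurable_dominated_simple:
  fixes f :: "'a \<Rightarrow> 'b::real_normed_vector"
  assumes f: "strongly_measurable M f" and fin: "(\<integral>\<^sup>+x. ennreal (norm (f x)) \<partial>M) < \<infinity>"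
  obtains s where "\<And>i. Bochner_Integration.simple_bochner_integrable M (s i)"
    "\<And>x. x \<in> space M \<Longrightarrow> (\<lambda>i. s i x) \<longlonglongrightarrow> f x"
    "(\<lambda>i. \<integral>\<^sup>+x. ennreal (norm (f x - s i x)) \<partial>M) \<longlonglongrightarrow> 0"
proof -
  obtain t where t: "\<And>i. simple_function M (t i)"
      "\<And>x. x \<in> space M \<Longrightarrow> (\<lambda>i. t i x) \<longlonglongrightarrow> f x"
    using f unfolding strongly_measurable_def by blast
  define s where "s i x = (if norm (t i x) \<le> 2 * norm (f x) then t i x else 0)" for i x
  have [measurable]: "(\<lambda>x. norm (f x)) \<in> borel_measurable M" "(\<lambda>x. norm (t i x)) \<in> borel_measurable M" for i
    by (intro borel_measurable_norm_strongly f strongly_measurable_simple t)+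
  have sf: "simple_function M (s i)" for i
    unfolding s_def by (intro simple_function_If t) measurable
  have le: "norm (s i x) \<le> 2 * norm (f x)" for i x
    by (simp add: s_def)
  have lim: "(\<lambda>i. s i x) \<longlonglongrightarrow> f x" if x: "x \<in> space M" for x
  proof (cases "f x = 0")
    case True
    then have "s i x = 0" for i by (simp add: s_def)
    with True show ?thesis by simp
  next
    case False
    then have "eventually (\<lambda>i. norm (t i x) < 2 * norm (f x)) sequentially"
      by (intro order_tendstoD(2)[OF tendsto_norm[OF t(2)[OF x]]]) simp
    then have "eventually (\<lambda>i. t i x = s i x) sequentially"
      by eventually_elim (simp add: s_def)
    with t(2)[OF x] show ?thesis by (rule Lim_transform_eventually)
  qed
  have fin2: "(\<integral>\<^sup>+x. ennreal (c * norm (f x)) \<partial>M) < \<infinity>" if "c \<ge> 0" for c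
    using fin that by (simp add: ennreal_mult nn_integral_cmult ennreal_mult_less_top)
  have "Bochner_Integration.simple_bochner_integrable M (s i)" for i
  proof (rule simple_bochner_integrableI_bounded[OF sf])
    have "(\<integral>\<^sup>+x. ennreal (norm (s i x)) \<partial>M) \<le> (\<integral>\<^sup>+x. ennreal (2 * norm (f x)) \<partial>M)"
      by (intro nn_integral_mono ennreal_leI le)
    also note fin2[of 2]
    finally show "(\<integral>\<^sup>+x. ennreal (norm (s i x)) \<partial>M) < \<infinity>" by simp
  qed
  moreover have "(\<lambda>i. \<integral>\<^sup>+x. ennreal (norm (f x - s i x)) \<partial>M) \<longlonglongrightarrow> (\<integral>\<^sup>+x. 0 \<partial>M)"
  proof (rule nn_integral_dominated_convergence[where w = "\<lambda>x. ennreal (3 * norm (f x))"])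
    show "(\<lambda>x. ennreal (norm (f x - s i x))) \<in> borel_measurable M" for i
      using borel_measurable_norm_diff_strongly[OF f strongly_measurable_simple[OF sf[of i]]] by simp
    show "AE x in M. ennreal (norm (f x - s i x)) \<le> ennreal (3 * norm (f x))" for i
    proof (intro AE_I2 ennreal_leI)
      fix x
      show "norm (f x - s i x) \<le> 3 * norm (f x)"
        using norm_triangle_ineq4[of "f x" "s i x"] le[of i x] by linarith
    qed
    show "AE x in M. (\<lambda>i. ennreal (norm (f x - s i x))) \<longlonglongrightarrow> 0"
    proof (intro AE_I2)
      fix x assume "x \<in> space M"
      then have "(\<lambda>i. norm (f x - s i x)) \<longlonglongrightarrow> norm (f x - f x)"
        by (intro tendsto_intros lim)
      then show "(\<lambda>i. ennreal (norm (f x - s i x))) \<longlonglongrightarrow> 0"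
        by (simp add: tendsto_ennreal_iff flip: ennreal_0)
    qed
  qed (use fin2[of 3] in auto)
  ultimately show ?thesis
    using that[of s] lim by simp
qed

text \<open>
  The integrals of the dominated approximations form a Cauchy sequence; completeness of the
  target provides the value of the integral.
\<close>

lemma strongly_integrableI:
  fixes f :: "'a \<Rightarrow> 'b::banach"
  assumes f: "strongly_measurable M f" and fin: "(\<integral>\<^sup>+x. ennreal (norm (f x)) \<partial>M) < \<infinity>"
  shows "strongly_integrable M f"
proof -
  obtain s where s: "\<And>i. Bochner_Integration.simple_bochner_integrable M (s i)"
    "\<And>x. x \<in> space M \<Longrightarrow> (\<lambda>i. s i x) \<longlonglongrightarrow> f x"
    "(\<lambda>i. \<integral>\<^sup>+x. ennreal (norm (f x - s i x)) \<partial>M) \<longlonglongrightarrow> 0"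
    using strongly_measurable_dominated_simple[OF f fin] by blast
  let ?I = "\<lambda>i. Bochner_Integration.simple_bochner_integral M (s i)"
  have "Cauchy ?I"
  proof (rule metric_CauchyI)
    fix e :: real assume "e > 0"
    then have "\<forall>\<^sub>F i in sequentially. (\<integral>\<^sup>+x. ennreal (norm (f x - s i x)) \<partial>M) < ennreal (e / 2)"
      by (intro order_tendstoD(2)[OF s(3)]) simp
    then obtain N where N: "\<And>i. i \<ge> N \<Longrightarrow> (\<integral>\<^sup>+x. ennreal (norm (f x - s i x)) \<partial>M) < ennreal (e / 2)"
      by (auto simp: eventually_sequentially)
    have "dist (?I i) (?I j) < e" if "i \<ge> N" "j \<ge> N" for i j
    proof -
      have "ennreal (dist (?I i) (?I j)) < ennreal (e / 2) + ennreal (e / 2)"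
        using simple_bochner_integral_dist_le[OF f s(1)[of i] s(1)[of j]] N[OF that(1)] N[OF that(2)]
        by (meson add_strict_mono le_less_trans)
      also have "\<dots> = ennreal e"
        using \<open>e > 0\<close> by (simp flip: ennreal_plus)
      finally show ?thesis
        using \<open>e > 0\<close> by (simp add: ennreal_less_iff)
    qed
    then show "\<exists>N. \<forall>m\<ge>N. \<forall>n\<ge>N. dist (?I m) (?I n) < e" by blast
  qed
  then obtain I where "?I \<longlonglongrightarrow> I"
    using Cauchy_convergent convergentD by blast
  then show ?thesis
    unfolding strongly_integrable_def has_strong_integral_def
    using s by (intro exI[of _ I] exI[of _ s] conjI) auto
qed

lemma has_bochner_integral_of_strong:
  fixes g :: "'a \<Rightarrow> 'b::real_normed_vector"
    and \<phi> :: "'b \<Rightarrow> 'c::{real_normed_vector, second_countable_topology}"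
  assumes f: "has_strong_integral M f I" and fg: "AE x in M. f x = g x"
    and g: "strongly_measurable M g" and \<phi>: "bounded_linear \<phi>"
  shows "has_bochner_integral M (\<lambda>x. \<phi> (g x)) (\<phi> I)"
proof -
  interpret \<phi>: bounded_linear \<phi> by fact
  obtain s where s: "\<And>i. Bochner_Integration.simple_bochner_integrable M (s i)"
    "(\<lambda>i. \<integral>\<^sup>+x. ennreal (norm (g x - s i x)) \<partial>M) \<longlonglongrightarrow> 0"
    "(\<lambda>i. Bochner_Integration.simple_bochner_integral M (s i)) \<longlonglongrightarrow> I"
    using f[unfolded has_strong_integral_cong_AE[OF fg]] unfolding has_strong_integral_def by blast
  obtain K where K: "K > 0" "\<And>x. norm (\<phi> x) \<le> norm x * K"
    using \<phi>.pos_bounded by blast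
  have sm: "strongly_measurable M (s i)" for i
    using s(1)[of i] by (auto intro: strongly_measurable_simple elim: simple_bochner_integrable.cases)
  note [measurable] = borel_measurable_norm_diff_strongly[OF g sm]
  show ?thesis
  proof (rule has_bochner_integral.intros[where s = "\<lambda>i x. \<phi> (s i x)"])
    show "(\<lambda>x. \<phi> (g x)) \<in> borel_measurable M"
      by (intro borel_measurable_strongly_measurable strongly_measurable_continuous[OF g]
          linear_continuous_on \<phi>)
    show "Bochner_Integration.simple_bochner_integrable M (\<lambda>x. \<phi> (s i x))" for i
      using simple_bochner_integrable_compose2[of "\<lambda>x y. \<phi> x" M "s i" "s i"] s(1)[of i]
      by (simp add: \<phi>.zero)
    show "(\<lambda>i. Bochner_Integration.simple_bochner_integral M (\<lambda>x. \<phi> (s i x))) \<longlonglongrightarrow> \<phi> I"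
      using \<phi>.tendsto[OF s(3)] s(1)
      by (simp add: simple_bochner_integral_linear bounded_linear.linear[OF \<phi>])
    show "(\<lambda>i. \<integral>\<^sup>+x. ennreal (norm (\<phi> (g x) - \<phi> (s i x))) \<partial>M) \<longlonglongrightarrow> 0"
    proof (rule tendsto_sandwich[where f = "\<lambda>_. 0"])
      show "\<forall>\<^sub>F i in sequentially. (\<integral>\<^sup>+x. ennreal (norm (\<phi> (g x) - \<phi> (s i x))) \<partial>M) \<le>
          ennreal K * (\<integral>\<^sup>+x. ennreal (norm (g x - s i x)) \<partial>M)"
        using K
        by (intro always_eventually allI, subst nn_integral_cmult[symmetric])
          (auto intro!: nn_integral_mono ennreal_leI
            simp: \<phi>.diff[symmetric] mult.commute simp flip: ennreal_mult)
      show "(\<lambda>i. ennreal K * (\<integral>\<^sup>+x. ennreal (norm (g x - s i x)) \<partial>M)) \<longlonglongrightarrow> 0"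
        using ennreal_tendsto_cmult[OF _ s(2), of "ennreal K"] by simp
    qed (auto intro!: always_eventually)
  qed
qed

lemma has_strong_integral_unique:
  fixes f :: "'a \<Rightarrow> 'b::real_normed_vector"
  assumes I: "has_strong_integral M f I" and J: "has_strong_integral M f J"
  shows "I = J"
proof -
  obtain g where g: "strongly_measurable M g" "AE x in M. f x = g x"
    using I strongly_integrable_imp_strongly_measurable[of M f]
    unfolding strongly_integrable_def by blast
  obtain s where s: "\<And>i. Bochner_Integration.simple_bochner_integrable M (s i)"
    "(\<lambda>i. \<integral>\<^sup>+x. ennreal (norm (g x - s i x)) \<partial>M) \<longlonglongrightarrow> 0"
    "(\<lambda>i. Bochner_Integration.simple_bochner_integral M (s i)) \<longlonglongrightarrow> I"
    using I[unfolded has_strong_integral_cong_AE[OF g(2)]] unfolding has_strong_integral_def by blast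
  obtain t where t: "\<And>i. Bochner_Integration.simple_bochner_integrable M (t i)"
    "(\<lambda>i. \<integral>\<^sup>+x. ennreal (norm (g x - t i x)) \<partial>M) \<longlonglongrightarrow> 0"
    "(\<lambda>i. Bochner_Integration.simple_bochner_integral M (t i)) \<longlonglongrightarrow> J"
    using J[unfolded has_strong_integral_cong_AE[OF g(2)]] unfolding has_strong_integral_def by blast
  have "(\<lambda>i. ennreal (dist (Bochner_Integration.simple_bochner_integral M (s i))
      (Bochner_Integration.simple_bochner_integral M (t i)))) \<longlonglongrightarrow> 0"
  proof (rule tendsto_sandwich[where f = "\<lambda>_. 0"])
    show "\<forall>\<^sub>F i in sequentially. ennreal (dist (Bochner_Integration.simple_bochner_integral M (s i))
        (Bochner_Integration.simple_bochner_integral M (t i))) \<le>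
      (\<integral>\<^sup>+x. ennreal (norm (g x - s i x)) \<partial>M) + (\<integral>\<^sup>+x. ennreal (norm (g x - t i x)) \<partial>M)"
      using simple_bochner_integral_dist_le[OF g(1) s(1) t(1)] by simp
    show "(\<lambda>i. (\<integral>\<^sup>+x. ennreal (norm (g x - s i x)) \<partial>M) + (\<integral>\<^sup>+x. ennreal (norm (g x - t i x)) \<partial>M)) \<longlonglongrightarrow> 0"
      using tendsto_add[OF s(2) t(2)] by simp
  qed auto
  moreover have "(\<lambda>i. ennreal (dist (Bochner_Integration.simple_bochner_integral M (s i))
      (Bochner_Integration.simple_bochner_integral M (t i)))) \<longlonglongrightarrow> ennreal (dist I J)"
    by (intro tendsto_ennrealI tendsto_dist s t)
  ultimately have "ennreal (dist I J) = 0"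
    by (rule LIMSEQ_unique[rotated])
  then show ?thesis by simp
qed

lemma has_strong_integral_strong_integral:
  "strongly_integrable M f \<Longrightarrow> has_strong_integral M f (strong_integral M f)"
  unfolding strong_integral_def
  by (auto simp: strongly_integrable_def intro: theI has_strong_integral_unique)

text \<open>
  Applied to point evaluations, this reduces integrals of functions with values in the right
  uniformly continuous functions to integrals of complex functions.
\<close>

lemma strong_integral_functional:
  fixes g :: "'a \<Rightarrow> 'b::banach"
    and \<phi> :: "'b \<Rightarrow> 'c::{banach, second_countable_topology}"
  assumes "strongly_measurable M g" "(\<integral>\<^sup>+x. ennreal (norm (g x)) \<partial>M) < \<infinity>"
    and "AE x in M. f x = g x" and "bounded_linear \<phi>"
  shows "\<phi> (strong_integral M f) = (\<integral>x. \<phi> (g x) \<partial>M)"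
  unfolding strong_integral_cong_AE[OF assms(3)]
  using has_bochner_integral_integral_eq[OF has_bochner_integral_of_strong[OF
      has_strong_integral_strong_integral[OF strongly_integrableI[OF assms(1,2)]] _ assms(1,4)]]
  by simp

lemma strong_integral_zero: "strong_integral M (\<lambda>x. 0 :: 'b::banach) = 0"
proof -
  have "Bochner_Integration.simple_bochner_integral M (\<lambda>x. 0 :: 'b) = 0"
    unfolding simple_bochner_integral_def by (rule sum.neutral) auto
  then have "has_strong_integral M (\<lambda>x. 0 :: 'b) 0"
    unfolding has_strong_integral_def
    by (intro exI[of _ "\<lambda>i x. 0"]) (auto intro!: simple_bochner_integrable.intros)
  then show ?thesis
    using has_strong_integral_unique has_strong_integral_strong_integral
    unfolding strongly_integrable_def by blast
qed

lemma norm_integral_le_nn_integral: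
  "ennreal (norm (integral\<^sup>L M f)) \<le> (\<integral>\<^sup>+x. ennreal (norm (f x)) \<partial>M)"
  by (cases "integrable M f") (simp_all add: integral_norm_bound_ennreal not_integrable_integral_eq)

section \<open>The space of right uniformly continuous functions\<close>

definition ruc_at :: "'g::topological_group_add \<Rightarrow> 'g ruc \<Rightarrow> complex" where
  "ruc_at z f = apply_bcontfun (bcontfun_of_ruc f) z"

lemma ruc_eqI: "(\<And>z. ruc_at z f = ruc_at z g) \<Longrightarrow> f = g"
  unfolding ruc_at_def by (metis bcontfun_eqI bcontfun_of_ruc_inject)

lemma ruc_at_simps [simp]:
  "ruc_at z (f * g) = ruc_at z f * ruc_at z g"
  "ruc_at z (f + g) = ruc_at z f + ruc_at z g"
  "ruc_at z (r *\<^sub>R f) = r *\<^sub>R ruc_at z f"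
  "ruc_at z 0 = 0"
  "ruc_at z (cnj_ruc f) = cnj (ruc_at z f)"
  "ruc_at z (cscale_ruc c f) = c * ruc_at z f"
  "ruc_at z (translate_ruc y f) = ruc_at (- y + z) f"
  by (simp_all add: ruc_at_def times_ruc.rep_eq plus_ruc.rep_eq scaleR_ruc.rep_eq zero_ruc.rep_eq
      cnj_ruc.rep_eq cscale_ruc.rep_eq translate_ruc.rep_eq)

lemma translate_ruc_zero [simp]: "translate_ruc y 0 = 0"
  by (rule ruc_eqI) simp

lemma cscale_ruc_simps [simp]: "cscale_ruc c 0 = 0" "cscale_ruc 1 f = f"
  by (rule ruc_eqI; simp)+

lemma norm_ruc_at_le: "norm (ruc_at z f) \<le> norm f"
  unfolding ruc_at_def norm_ruc.rep_eq by (rule norm_bounded)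

lemma norm_ruc_leI: "(\<And>z. norm (ruc_at z f) \<le> b) \<Longrightarrow> norm f \<le> b"
  unfolding ruc_at_def norm_ruc.rep_eq by (rule norm_bound)

lemma bounded_linear_ruc_at: "bounded_linear (ruc_at z)"
  by (rule bounded_linear_intro[where K = 1]) (simp_all add: norm_ruc_at_le)

lemma continuous_on_translate_bcontfun_of_ruc:
  "continuous_on UNIV (\<lambda>y. translate_bcontfun y (bcontfun_of_ruc f))"
  using bcontfun_of_ruc[of f] by simp

lemma norm_translate_bcontfun: "norm (translate_bcontfun y f) \<le> norm f"
  by (rule norm_bound) (simp add: norm_bounded)

text \<open>
  A uniform limit of right uniformly continuous functions is right uniformly continuous, because
  translations are isometric; hence the space is complete and Bochner integrals exist in it.
\<close>

instance ruc :: (topological_group_add) banach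
proof
  fix X :: "nat \<Rightarrow> 'a ruc"
  assume "Cauchy X"
  have "uniformly_Cauchy_on UNIV (\<lambda>n. apply_bcontfun (bcontfun_of_ruc (X n)))"
  proof (rule uniformly_Cauchy_onI)
    fix e :: real assume "e > 0"
    with \<open>Cauchy X\<close> obtain N where "\<forall>m\<ge>N. \<forall>n\<ge>N. dist (X m) (X n) < e"
      unfolding Cauchy_def by blast
    then show "\<exists>N. \<forall>x\<in>UNIV. \<forall>m\<ge>N. \<forall>n\<ge>N.
        dist (bcontfun_of_ruc (X m) x) (bcontfun_of_ruc (X n) x) < e"
      unfolding dist_ruc.rep_eq by (blast intro: dist_fun_lt_imp_dist_val_lt)
  qed
  from Cauchy_uniformly_convergent[OF this]
  obtain k where "uniform_limit UNIV (\<lambda>n. apply_bcontfun (bcontfun_of_ruc (X n))) k sequentially"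
    unfolding uniformly_convergent_on_def ..
  from uniform_limit_bcontfunE[OF this sequentially_bot]
  obtain l where l: "(\<lambda>n. bcontfun_of_ruc (X n)) \<longlonglongrightarrow> l" .
  have "uniform_limit UNIV (\<lambda>n y. translate_bcontfun y (bcontfun_of_ruc (X n)))
      (\<lambda>y. translate_bcontfun y l) sequentially"
  proof (rule uniform_limitI)
    fix e :: real assume "e > 0"
    with l have "\<forall>\<^sub>F n in sequentially. dist (bcontfun_of_ruc (X n)) l < e"
      by (rule tendstoD)
    then show "\<forall>\<^sub>F n in sequentially. \<forall>y\<in>UNIV.
        dist (translate_bcontfun y (bcontfun_of_ruc (X n))) (translate_bcontfun y l) < e"
    proof eventually_elim
      case (elim n)
      have "dist (translate_bcontfun y (bcontfun_of_ruc (X n))) (translate_bcontfun y l) < e" for y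
        using le_less_trans[OF norm_translate_bcontfun[of y "bcontfun_of_ruc (X n) - l"]] elim
        by (simp add: dist_norm translate_bcontfun_algebra)
      then show ?case by blast
    qed
  qed
  then have "continuous_on UNIV (\<lambda>y. translate_bcontfun y l)"
  proof (rule uniform_limit_theorem[rotated])
    show "\<forall>\<^sub>F n in sequentially. continuous_on UNIV (\<lambda>y. translate_bcontfun y (bcontfun_of_ruc (X n)))"
      by (intro always_eventually allI continuous_on_translate_bcontfun_of_ruc)
  qed simp
  then have L: "bcontfun_of_ruc (Abs_ruc l) = l"
    by (simp add: Abs_ruc_inverse)
  have "X \<longlonglongrightarrow> Abs_ruc l"
    using l tendsto_dist_iff[of X] tendsto_dist_iff[of "\<lambda>n. bcontfun_of_ruc (X n)"]
    by (simp add: dist_ruc.rep_eq L)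
  then show "convergent X"
    by (auto simp: convergent_def)
qed

lemma continuous_on_translate_ruc: "continuous_on UNIV (\<lambda>y. translate_ruc y f)"
proof -
  have "((\<lambda>z. dist (translate_bcontfun z (bcontfun_of_ruc f))
      (translate_bcontfun y (bcontfun_of_ruc f))) \<longlongrightarrow> 0) (at y)" for y
    using continuous_on_translate_bcontfun_of_ruc[of f]
    by (simp add: continuous_on_def tendsto_dist_iff[symmetric])
  then show ?thesis
    by (simp add: continuous_on_def tendsto_dist_iff[of "\<lambda>z. translate_ruc z f"]
        dist_ruc.rep_eq translate_ruc.rep_eq)
qed


section \<open>Coordinates on the affine group\<close>

text \<open>
  The logarithm of the scaling factor is used as a coordinate, so that the group becomes the
  whole plane and every pair of real numbers is admissible.
\<close>

definition log_scale :: "affine_group \<Rightarrow> real" where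
  "log_scale x = ln (matrix_of x $ 1 $ 1)"

definition shift :: "affine_group \<Rightarrow> real" where
  "shift x = matrix_of x $ 1 $ 2"

definition aff :: "real \<Rightarrow> real \<Rightarrow> affine_group" where
  "aff s t = Abs_affine_group (vector [vector [exp s, t], vector [0, 1]])"

lemma matrix_of_affine: "matrix_of (aff s t) = vector [vector [exp s, t], vector [0, 1]]"
  unfolding aff_def by (rule Abs_affine_group_inverse) auto

lemma log_scale_affine [simp]: "log_scale (aff s t) = s"
  and shift_affine [simp]: "shift (aff s t) = t"
  by (simp_all add: log_scale_def shift_def matrix_of_affine)

lemma affine_cases [cases type: affine_group]: obtains s t where "x = aff s t"
proof -
  obtain a b where a: "a > 0" and x: "matrix_of x = vector [vector [a, b], vector [0, 1]]"
    using matrix_of[of x] by auto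
  then have "matrix_of x = matrix_of (aff (ln a) b)"
    by (simp add: matrix_of_affine)
  then show ?thesis
    using that by (simp only: matrix_of_inject)
qed

lemma affine_eta [simp]: "aff (log_scale x) (shift x) = x"
  by (cases x) simp

lemma affine_plus: "aff s t + aff s' t' = aff (s + s') (exp s * t' + t)"
  by (simp add: plus_affine_group.rep_eq matrix_of_affine affine_mult exp_add
      flip: matrix_of_inject)

lemma affine_zero: "aff 0 0 = 0"
  by (simp add: zero_affine_group.rep_eq matrix_of_affine affine_one flip: matrix_of_inject)

lemma affine_uminus: "- aff s t = aff (- s) (- (exp (- s) * t))"
proof -
  have "aff s t + aff (- s) (- (exp (- s) * t)) = 0"
    by (simp add: affine_plus affine_zero flip: mult.assoc exp_add)
  then show ?thesis
    by (rule minus_unique)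
qed

lemma log_scale_simps [simp]:
  "log_scale (x + y) = log_scale x + log_scale y" "log_scale (- x) = - log_scale x"
  "log_scale 0 = 0"
proof -
  obtain s t s' t' where "x = aff s t" "y = aff s' t'"
    using affine_cases by metis
  then show "log_scale (x + y) = log_scale x + log_scale y" "log_scale (- x) = - log_scale x"
    by (simp_all add: affine_plus affine_uminus)
qed (simp flip: affine_zero)

lemma shift_simps:
  "shift (x + y) = exp (log_scale x) * shift y + shift x"
  "shift (- x) = - (exp (- log_scale x) * shift x)"
  "shift 0 = 0"
proof -
  obtain s t s' t' where "x = aff s t" "y = aff s' t'"
    using affine_cases by metis
  then show "shift (x + y) = exp (log_scale x) * shift y + shift x"
      "shift (- x) = - (exp (- log_scale x) * shift x)"
    by (simp_all add: affine_plus affine_uminus)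
qed (simp flip: affine_zero)

lemma continuous_on_matrix_of: "continuous_on UNIV matrix_of"
  unfolding continuous_on_def
proof
  fix x
  show "(matrix_of \<longlongrightarrow> matrix_of x) (at x within UNIV)"
    using tendsto_affine_group_iff[of "\<lambda>x. x" x "at x"] by (simp add: tendsto_ident_at)
qed

lemma continuous_on_log_scale: "continuous_on UNIV log_scale"
proof -
  have "matrix_of x $ 1 $ 1 \<noteq> 0" for x
    by (cases x) (simp add: matrix_of_affine)
  then show ?thesis
    unfolding log_scale_def by (auto intro!: continuous_intros continuous_on_matrix_of)
qed

lemma continuous_on_shift: "continuous_on UNIV shift"
  unfolding shift_def by (intro continuous_intros continuous_on_matrix_of)

lemma continuous_on_affine: "continuous_on UNIV (\<lambda>(s, t). aff s t)"
  unfolding continuous_on_def tendsto_affine_group_iff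
proof (intro ballI vec_tendstoI)
  fix p :: "real \<times> real" and i j :: 2
  show "((\<lambda>x. matrix_of (case x of (s, t) \<Rightarrow> aff s t) $ i $ j) \<longlongrightarrow>
      matrix_of (case p of (s, t) \<Rightarrow> aff s t) $ i $ j) (at p within UNIV)"
    using exhaust_2[of i] exhaust_2[of j]
    by (elim disjE; simp add: case_prod_beta matrix_of_affine)
      (intro tendsto_exp tendsto_fst tendsto_snd tendsto_ident_at)+
qed

instance affine_group :: second_countable_topology
proof
  obtain \<B> :: "(real^2^2) set set" where \<B>: "countable \<B>" "topological_basis \<B>"
    using ex_countable_basis by blast
  let ?B = "(\<lambda>V. matrix_of -` V) ` \<B>"
  have "topological_basis ?B"
  proof (rule topological_basisI)
    show "open U" if "U \<in> ?B" for U
      using that topological_basis_open[OF \<B>(2)] by (auto simp: open_affine_group_def)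
    fix U :: "affine_group set" and x
    assume "open U" "x \<in> U"
    then obtain V where "open V" "U = matrix_of -` V" "matrix_of x \<in> V"
      by (auto simp: open_affine_group_def)
    then show "\<exists>B'\<in>?B. x \<in> B' \<and> B' \<subseteq> U"
      using topological_basisE[OF \<B>(2), of V "matrix_of x"] by (metis imageI vimageI vimage_mono)
  qed
  then show "\<exists>B::affine_group set set. countable B \<and> open = generate_topology B"
    using \<B>(1) topological_basis_imp_subbasis countable_image by blast
qed

lemma measurable_coordinates [measurable]:
  "log_scale \<in> borel_measurable borel" "shift \<in> borel_measurable borel"
  "(\<lambda>p. aff (fst p) (snd p)) \<in> borel \<rightarrow>\<^sub>M borel"
  "(uminus :: affine_group \<Rightarrow> affine_group) \<in> borel \<rightarrow>\<^sub>M borel"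
  using continuous_on_log_scale continuous_on_shift continuous_on_affine
  by (auto intro!: borel_measurable_continuous_onI continuous_intros simp: case_prod_beta')

lemma measurable_affine [measurable (raw)]:
  assumes "f \<in> borel_measurable M" "g \<in> borel_measurable M"
  shows "(\<lambda>x. aff (f x) (g x)) \<in> M \<rightarrow>\<^sub>M borel"
  using measurable_compose[OF borel_measurable_Pair[OF assms] measurable_coordinates(3)] by simp

text \<open>
  The coordinates make the identity of the group a pointwise limit of simple functions, whence
  every continuous function on it is strongly measurable, whatever its target.
\<close>

lemma strongly_measurable_continuous_affine_group:
  fixes f :: "affine_group \<Rightarrow> 'b::topological_space"
  assumes "continuous_on UNIV f" "sets M = sets borel"
  shows "strongly_measurable M f"
proof -
  have [measurable_cong]: "sets M = sets borel" by fact
  have "(\<lambda>x. (log_scale x, shift x)) \<in> borel_measurable M" by measurable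
  then have "strongly_measurable M (\<lambda>x. (log_scale x, shift x))"
    by (rule strongly_measurable_borel)
  from strongly_measurable_continuous[OF strongly_measurable_continuous[OF this continuous_on_affine]
      assms(1)]
  show ?thesis by simp
qed


section \<open>The bump function\<close>

definition tent :: "real \<Rightarrow> real" where
  "tent t = max 0 (1 - \<bar>t\<bar>)"

lemma tent_lipschitz: "\<bar>tent t - tent u\<bar> \<le> \<bar>t - u\<bar>"
  by (auto simp: tent_def max_def)

lemma tent_bounds: "0 \<le> tent t" "tent t \<le> 1"
  by (auto simp: tent_def)

lemma tent_eq_0: "1 \<le> \<bar>t\<bar> \<Longrightarrow> tent t = 0"
  by (auto simp: tent_def)

lemma continuous_on_tent [continuous_intros]:
  "continuous_on A f \<Longrightarrow> continuous_on A (\<lambda>x. tent (f x))"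
  unfolding tent_def by (intro continuous_intros)

lemma measurable_tent [measurable]: "tent \<in> borel_measurable borel"
  by (intro borel_measurable_continuous_onI continuous_intros)

definition bump_bcontfun :: "affine_group \<Rightarrow>\<^sub>C complex" where
  "bump_bcontfun = Bcontfun (\<lambda>z. complex_of_real (tent (shift z)))"

lemma bump_bcontfun_apply [simp]: "bump_bcontfun z = tent (shift z)"
proof -
  have "(\<lambda>z. complex_of_real (tent (shift z))) \<in> bcontfun"
    by (rule bcontfun_normI[where b = 1])
      (auto intro!: continuous_intros continuous_on_shift simp: tent_bounds abs_of_nonneg)
  then show ?thesis
    by (simp add: bump_bcontfun_def Bcontfun_inverse)
qed

text \<open>
  If one of the two points \<open>- x + z\<close>, \<open>- y + z\<close> has shift at most \<open>1\<close>, then their shifts differ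
  by an affine function of that bounded shift, with coefficients that vanish for \<open>x = y\<close>;
  otherwise both values are \<open>0\<close>. As the bound is uniform in \<open>z\<close>, it shows that translation acts
  norm continuously on the tent function of the shift.
\<close>

lemma tent_translate_diff:
  "\<bar>tent (shift (- x + z)) - tent (shift (- y + z))\<bar> \<le>
    (\<bar>exp (log_scale x) - exp (log_scale y)\<bar> + \<bar>shift x - shift y\<bar>) *
    (exp (- log_scale x) + exp (- log_scale y))"
proof -
  have *: "\<bar>tent (shift (- x + z)) - tent (shift (- y + z))\<bar> \<le>
    (\<bar>exp (log_scale x) - exp (log_scale y)\<bar> + \<bar>shift x - shift y\<bar>) * exp (- log_scale y)"
    if "\<bar>shift (- x + z)\<bar> \<le> 1" for x y
  proof -
    let ?p = "shift (- x + z)" and ?q = "shift (- y + z)"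
    have "?p - ?q = ((exp (log_scale y) - exp (log_scale x)) * ?p + (shift y - shift x)) *
        exp (- log_scale y)"
      by (simp add: shift_simps exp_minus divide_simps) (simp add: algebra_simps)
    then have "\<bar>?p - ?q\<bar> \<le> \<bar>(exp (log_scale y) - exp (log_scale x)) * ?p + (shift y - shift x)\<bar> *
        exp (- log_scale y)"
      by (simp add: abs_mult)
    also have "\<dots> \<le> (\<bar>exp (log_scale y) - exp (log_scale x)\<bar> * \<bar>?p\<bar> + \<bar>shift y - shift x\<bar>) *
        exp (- log_scale y)"
      by (intro mult_right_mono order_trans[OF abs_triangle_ineq]) (simp_all add: abs_mult)
    also have "\<dots> \<le> (\<bar>exp (log_scale y) - exp (log_scale x)\<bar> * 1 + \<bar>shift y - shift x\<bar>) *
        exp (- log_scale y)"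
      using that by (intro mult_right_mono add_mono mult_left_mono) simp_all
    finally show ?thesis
      using tent_lipschitz[of ?p ?q] by (simp add: abs_minus_commute)
  qed
  let ?d = "\<bar>exp (log_scale x) - exp (log_scale y)\<bar> + \<bar>shift x - shift y\<bar>"
  have nonneg: "0 \<le> ?d * exp (- log_scale x)" "0 \<le> ?d * exp (- log_scale y)"
    by simp_all
  consider "\<bar>shift (- x + z)\<bar> \<le> 1" | "\<bar>shift (- y + z)\<bar> \<le> 1"
    | "1 \<le> \<bar>shift (- x + z)\<bar>" "1 \<le> \<bar>shift (- y + z)\<bar>"
    by linarith
  then show ?thesis
  proof cases
    case 1
    from *[OF this, of y] nonneg show ?thesis
      unfolding distrib_left by linarith
  next
    case 2
    from *[OF this, of x] nonneg show ?thesis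
      unfolding distrib_left abs_minus_commute[of "exp (log_scale y)"]
        abs_minus_commute[of "shift y"] abs_minus_commute[of "tent (shift (- y + z))"]
      by linarith
  qed (simp add: tent_eq_0)
qed

lemma continuous_on_translate_bump: "continuous_on UNIV (\<lambda>y. translate_bcontfun y bump_bcontfun)"
  unfolding continuous_on_def
proof
  fix y
  let ?d = "\<lambda>x. (\<bar>exp (log_scale x) - exp (log_scale y)\<bar> + \<bar>shift x - shift y\<bar>) *
    (exp (- log_scale x) + exp (- log_scale y))"
  have "continuous_on UNIV ?d"
    by (intro continuous_intros continuous_on_log_scale continuous_on_shift)
  then have "(?d \<longlongrightarrow> ?d y) (at y)"
    unfolding continuous_on_def by blast
  then have lim: "(?d \<longlongrightarrow> 0) (at y)" by simp
  have le: "norm (translate_bcontfun x bump_bcontfun - translate_bcontfun y bump_bcontfun) \<le> ?d x"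
    for x
  proof (rule norm_bound)
    fix z
    show "norm ((translate_bcontfun x bump_bcontfun - translate_bcontfun y bump_bcontfun) z) \<le> ?d x"
      using tent_translate_diff[of x z y]
      by (simp only: minus_bcontfun.rep_eq translate_bcontfun.rep_eq bump_bcontfun_apply
          norm_of_real flip: of_real_diff)
  qed
  show "((\<lambda>x. translate_bcontfun x bump_bcontfun) \<longlongrightarrow> translate_bcontfun y bump_bcontfun)
      (at y within UNIV)"
    by (rule LIM_zero_cancel[OF Lim_null_comparison[OF always_eventually[OF allI[OF le]] lim]])
qed

definition bump :: "affine_group ruc" where
  "bump = Abs_ruc bump_bcontfun"

lemma ruc_at_bump [simp]: "ruc_at z bump = tent (shift z)"
  by (simp add: ruc_at_def bump_def Abs_ruc_inverse continuous_on_translate_bump)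

lemma norm_translate_bump_le: "norm (translate_ruc y bump) \<le> 1"
  by (intro norm_ruc_leI) (simp add: tent_bounds abs_of_nonneg)

section \<open>Haar measure on the affine group\<close>

text \<open>
  With \<open>a = exp s\<close> this is the measure \<open>da db / a\<^sup>2\<close>.
\<close>

definition affine_measure :: "affine_group measure" where
  "affine_measure =
    distr (density (lborel \<Otimes>\<^sub>M lborel) (\<lambda>p. ennreal (exp (- fst p)))) borel (\<lambda>p. aff (fst p) (snd p))"

lemma sets_affine_measure [simp, measurable_cong]: "sets affine_measure = sets borel"
  by (simp add: affine_measure_def)

lemma nn_integral_affine_measure:
  assumes [measurable]: "f \<in> borel_measurable borel"
  shows "(\<integral>\<^sup>+x. f x \<partial>affine_measure) =
    (\<integral>\<^sup>+s. ennreal (exp (- s)) * (\<integral>\<^sup>+t. f (aff s t) \<partial>lborel) \<partial>lborel)"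
proof -
  have "(\<integral>\<^sup>+x. f x \<partial>affine_measure) =
      (\<integral>\<^sup>+p. ennreal (exp (- fst p)) * f (aff (fst p) (snd p)) \<partial>(lborel \<Otimes>\<^sub>M lborel))"
    unfolding affine_measure_def
    by (subst nn_integral_distr) (auto simp: nn_integral_density)
  also have "\<dots> = (\<integral>\<^sup>+s. (\<integral>\<^sup>+t. ennreal (exp (- s)) * f (aff s t) \<partial>lborel) \<partial>lborel)"
    by (subst lborel.nn_integral_fst[symmetric]) auto
  also have "\<dots> = (\<integral>\<^sup>+s. ennreal (exp (- s)) * (\<integral>\<^sup>+t. f (aff s t) \<partial>lborel) \<partial>lborel)"
    by (intro nn_integral_cong nn_integral_cmult) auto
  finally show ?thesis .
qed

lemma nn_integral_lborel_shift:
  fixes f :: "real \<Rightarrow> ennreal"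
  assumes "f \<in> borel_measurable borel"
  shows "(\<integral>\<^sup>+s. f (c + s) \<partial>lborel) = (\<integral>\<^sup>+s. f s \<partial>lborel)"
  using nn_integral_real_affine[OF assms, of 1 c] by simp

lemma nn_integral_lborel_scale:
  fixes f :: "real \<Rightarrow> ennreal"
  assumes "f \<in> borel_measurable borel"
  shows "(\<integral>\<^sup>+t. f (exp s * t + c) \<partial>lborel) = ennreal (exp (- s)) * (\<integral>\<^sup>+t. f t \<partial>lborel)"
  using nn_integral_real_affine[OF assms, of "exp s" c]
  by (simp add: add.commute flip: mult.assoc ennreal_mult exp_add)

lemma affine_measure_left:
  assumes [measurable]: "f \<in> borel_measurable borel"
  shows "(\<integral>\<^sup>+x. f (y + x) \<partial>affine_measure) = (\<integral>\<^sup>+x. f x \<partial>affine_measure)"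
proof (cases y)
  case (1 u v)
  have "(\<integral>\<^sup>+x. f (y + x) \<partial>affine_measure) =
      (\<integral>\<^sup>+s. ennreal (exp (- s)) * (\<integral>\<^sup>+t. f (aff (u + s) (exp u * t + v)) \<partial>lborel) \<partial>lborel)"
    by (subst nn_integral_affine_measure) (auto simp: 1 affine_plus)
  also have "\<dots> = (\<integral>\<^sup>+s. ennreal (exp (- (u + s))) * (\<integral>\<^sup>+t. f (aff (u + s) t) \<partial>lborel) \<partial>lborel)"
  proof (rule nn_integral_cong)
    fix s :: real
    have "exp (- s) * exp (- u) = exp (- (u + s))"
      by (simp flip: exp_add)
    then show "ennreal (exp (- s)) * (\<integral>\<^sup>+t. f (aff (u + s) (exp u * t + v)) \<partial>lborel) =
        ennreal (exp (- (u + s))) * (\<integral>\<^sup>+t. f (aff (u + s) t) \<partial>lborel)"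
      by (subst nn_integral_lborel_scale) (auto simp flip: mult.assoc ennreal_mult)
  qed
  also have "\<dots> = (\<integral>\<^sup>+s. ennreal (exp (- s)) * (\<integral>\<^sup>+t. f (aff s t) \<partial>lborel) \<partial>lborel)"
    by (rule nn_integral_lborel_shift) auto
  finally show ?thesis by (simp add: nn_integral_affine_measure)
qed

lemma affine_measure_right:
  assumes [measurable]: "f \<in> borel_measurable borel"
  shows "(\<integral>\<^sup>+x. f (x + y) \<partial>affine_measure) =
    ennreal (exp (log_scale y)) * (\<integral>\<^sup>+x. f x \<partial>affine_measure)"
proof (cases y)
  case (1 u v)
  have "(\<integral>\<^sup>+x. f (x + y) \<partial>affine_measure) =
      (\<integral>\<^sup>+s. ennreal (exp (- s)) * (\<integral>\<^sup>+t. f (aff (s + u) (exp s * v + t)) \<partial>lborel) \<partial>lborel)"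
    by (subst nn_integral_affine_measure) (auto simp: 1 affine_plus)
  also have "\<dots> = (\<integral>\<^sup>+s. ennreal (exp u) * (ennreal (exp (- (u + s))) *
      (\<integral>\<^sup>+t. f (aff (u + s) t) \<partial>lborel)) \<partial>lborel)"
    by (intro nn_integral_cong, subst nn_integral_lborel_shift)
      (auto simp: add.commute simp flip: mult.assoc ennreal_mult exp_add)
  also have "\<dots> = ennreal (exp u) * (\<integral>\<^sup>+s. ennreal (exp (- (u + s))) *
      (\<integral>\<^sup>+t. f (aff (u + s) t) \<partial>lborel) \<partial>lborel)"
    by (rule nn_integral_cmult) auto
  also have "(\<integral>\<^sup>+s. ennreal (exp (- (u + s))) * (\<integral>\<^sup>+t. f (aff (u + s) t) \<partial>lborel) \<partial>lborel) =
      (\<integral>\<^sup>+s. ennreal (exp (- s)) * (\<integral>\<^sup>+t. f (aff s t) \<partial>lborel) \<partial>lborel)"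
    by (rule nn_integral_lborel_shift) auto
  finally show ?thesis by (simp add: nn_integral_affine_measure 1)
qed

lemma affine_measure_uminus:
  assumes [measurable]: "f \<in> borel_measurable borel"
  shows "(\<integral>\<^sup>+x. f (- x) \<partial>affine_measure) =
    (\<integral>\<^sup>+x. ennreal (exp (log_scale x)) * f x \<partial>affine_measure)"
proof -
  have "(\<integral>\<^sup>+x. f (- x) \<partial>affine_measure) =
      (\<integral>\<^sup>+s. ennreal (exp (- s)) * (\<integral>\<^sup>+t. f (aff (- s) (- (exp (- s) * t))) \<partial>lborel) \<partial>lborel)"
    by (subst nn_integral_affine_measure) (auto simp: affine_uminus)
  also have "\<dots> = (\<integral>\<^sup>+s. (\<integral>\<^sup>+t. f (aff (- s) t) \<partial>lborel) \<partial>lborel)"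
  proof (rule nn_integral_cong)
    fix s :: real
    show "ennreal (exp (- s)) * (\<integral>\<^sup>+t. f (aff (- s) (- (exp (- s) * t))) \<partial>lborel) =
        (\<integral>\<^sup>+t. f (aff (- s) t) \<partial>lborel)"
      using nn_integral_real_affine[of "\<lambda>t. f (aff (- s) t)" "- exp (- s)" 0] by simp
  qed
  also have "\<dots> = (\<integral>\<^sup>+s. (\<integral>\<^sup>+t. f (aff s t) \<partial>lborel) \<partial>lborel)"
    using nn_integral_real_affine[of "\<lambda>s. (\<integral>\<^sup>+t. f (aff s t) \<partial>lborel)" "- 1" 0] by simp
  also have "\<dots> = (\<integral>\<^sup>+s. ennreal (exp (- s)) * (\<integral>\<^sup>+t. ennreal (exp s) * f (aff s t) \<partial>lborel) \<partial>lborel)"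
    by (intro nn_integral_cong, subst nn_integral_cmult)
      (auto simp flip: mult.assoc ennreal_mult exp_add)
  finally show ?thesis by (simp add: nn_integral_affine_measure)
qed

definition box_set :: "real \<Rightarrow> affine_group set" where
  "box_set r = {x. \<bar>log_scale x\<bar> \<le> r \<and> \<bar>shift x\<bar> \<le> r}"

lemma measurable_box_set [measurable]: "box_set r \<in> sets borel"
  unfolding box_set_def by measurable

lemma compact_box_set: "compact (box_set r)"
proof -
  have "box_set r = (\<lambda>(s, t). aff s t) ` ({- r..r} \<times> {- r..r})"
  proof (intro equalityI subsetI)
    fix x assume "x \<in> box_set r"
    then show "x \<in> (\<lambda>(s, t). aff s t) ` ({- r..r} \<times> {- r..r})"
      by (intro image_eqI[of _ _ "(log_scale x, shift x)"]) (auto simp: box_set_def abs_le_iff)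
  qed (auto simp: box_set_def abs_le_iff)
  also have "compact \<dots>"
    by (intro compact_continuous_image compact_Times compact_Icc
        continuous_on_subset[OF continuous_on_affine]) auto
  finally show ?thesis .
qed

lemma UN_box_set: "(\<Union>n. box_set (real n)) = UNIV"
proof (intro equalityI subsetI)
  fix x
  obtain n where "max \<bar>log_scale x\<bar> \<bar>shift x\<bar> \<le> real n"
    using real_arch_simple by blast
  then show "x \<in> (\<Union>n. box_set (real n))"
    by (auto simp: box_set_def)
qed simp

text \<open>
  The sets \<open>box_set n\<close> are compact and cover the group, so that this applies to every measure that
  is finite on compact sets.
\<close>

lemma sigma_finite_box_set:
  assumes "sets M = sets borel" "\<And>n. emeasure M (box_set (real n)) < \<infinity>"
  shows "sigma_finite_measure M"
proof (rule sigma_finite_measure.intro, intro exI conjI)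
  have "space M = UNIV"
    using sets_eq_imp_space_eq[OF assms(1)] by simp
  then show "\<Union>(range (\<lambda>n. box_set (real n))) = space M"
    by (simp add: UN_box_set)
  show "\<forall>a\<in>range (\<lambda>n. box_set (real n)). emeasure M a \<noteq> \<infinity>"
    using assms(2) by (metis less_irrefl imageE)
qed (auto simp: assms(1))

lemma emeasure_affine_measure:
  assumes [measurable]: "A \<in> sets borel"
  shows "emeasure affine_measure A =
    (\<integral>\<^sup>+s. ennreal (exp (- s)) * (\<integral>\<^sup>+t. indicator A (aff s t) \<partial>lborel) \<partial>lborel)"
  by (subst nn_integral_affine_measure[symmetric]) auto

lemma emeasure_affine_measure_box_less_top: "emeasure affine_measure (box_set r) < \<infinity>"
proof -
  have "emeasure affine_measure (box_set r) \<le>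
      (\<integral>\<^sup>+s. ennreal (exp r) * ennreal (2 * \<bar>r\<bar>) * indicator {- r..r} s \<partial>lborel)"
    unfolding emeasure_affine_measure[OF measurable_box_set]
  proof (intro nn_integral_mono)
    fix s :: real
    have "(\<integral>\<^sup>+t. indicator (box_set r) (aff s t) \<partial>lborel) \<le>
        (\<integral>\<^sup>+t. indicator {- r..r} t \<partial>lborel)"
      by (intro nn_integral_mono) (auto simp: box_set_def indicator_def)
    also have "\<dots> \<le> ennreal (2 * \<bar>r\<bar>)"
      by (cases "r \<ge> 0") auto
    finally have le: "(\<integral>\<^sup>+t. indicator (box_set r) (aff s t) \<partial>lborel) \<le> ennreal (2 * \<bar>r\<bar>)" .
    show "ennreal (exp (- s)) * (\<integral>\<^sup>+t. indicator (box_set r) (aff s t) \<partial>lborel) \<le>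
        ennreal (exp r) * ennreal (2 * \<bar>r\<bar>) * indicator {- r..r} s"
    proof (cases "s \<in> {- r..r}")
      case True
      then show ?thesis
        using le by (simp add: mult_mono)
    next
      case False
      then have "indicator (box_set r) (aff s t) = (0::ennreal)" for t
        by (auto simp: box_set_def indicator_def)
      then show ?thesis by simp
    qed
  qed
  also have "\<dots> < \<infinity>"
    by (cases "r \<ge> 0") (simp_all add: nn_integral_cmult_indicator ennreal_mult_less_top)
  finally show ?thesis .
qed

lemma emeasure_affine_measure_pos:
  assumes [measurable]: "A \<in> sets borel" and "a < b" "c < d"
    and A: "\<And>s t. a < s \<Longrightarrow> s < b \<Longrightarrow> c < t \<Longrightarrow> t < d \<Longrightarrow> aff s t \<in> A"
  shows "0 < emeasure affine_measure A"
proof -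
  have "0 < ennreal (exp (- b) * (d - c) * (b - a))"
    using assms by simp
  also have "\<dots> = (\<integral>\<^sup>+s. ennreal (exp (- b) * (d - c)) * indicator {a<..<b} s \<partial>lborel)"
    using assms by (subst nn_integral_cmult_indicator) (auto simp flip: ennreal_mult)
  also have "\<dots> \<le> emeasure affine_measure A"
    unfolding emeasure_affine_measure[OF assms(1)]
  proof (intro nn_integral_mono)
    fix s :: real
    show "ennreal (exp (- b) * (d - c)) * indicator {a<..<b} s \<le>
        ennreal (exp (- s)) * (\<integral>\<^sup>+t. indicator A (aff s t) \<partial>lborel)"
    proof (cases "s \<in> {a<..<b}")
      case True
      then have "(\<integral>\<^sup>+t. indicator {c<..<d} t \<partial>lborel) \<le> (\<integral>\<^sup>+t. indicator A (aff s t) \<partial>lborel)"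
        using A by (intro nn_integral_mono) (auto simp: indicator_def)
      then have "ennreal (d - c) \<le> (\<integral>\<^sup>+t. indicator A (aff s t) \<partial>lborel)"
        using assms(3) by simp
      with True assms(3) show ?thesis
        by (simp add: ennreal_mult mult_mono)
    qed simp
  qed
  finally show ?thesis .
qed

lemma sigma_finite_affine_measure: "sigma_finite_measure affine_measure"
  by (rule sigma_finite_box_set) (simp_all add: emeasure_affine_measure_box_less_top[simplified])

locale affine_haar =
  fixes \<mu> :: "affine_group measure"
  assumes haar: "left_haar_measure \<mu>"
begin

lemma sets_haar [simp, measurable_cong]: "sets \<mu> = sets borel"
  using haar by (simp add: left_haar_measure_def)

lemma space_haar [simp]: "space \<mu> = UNIV"
  using sets_eq_imp_space_eq[OF sets_haar] by simp

lemma emeasure_box_less_top: "emeasure \<mu> (box_set r) < \<infinity>"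
  using haar compact_box_set unfolding left_haar_measure_def by blast

sublocale sigma_finite_measure \<mu>
  by (rule sigma_finite_box_set) (simp_all add: emeasure_box_less_top[simplified])

lemma distr_left: "distr \<mu> borel ((+) y) = \<mu>"
proof (rule measure_eqI)
  fix A assume "A \<in> sets (distr \<mu> borel ((+) y))"
  then have A [measurable]: "A \<in> sets borel" by simp
  have "(+) y -` A = (+) (- y) ` A"
    by (auto simp: image_iff add.assoc[symmetric] intro!: bexI[of _ "y + x" for x])
  then show "emeasure (distr \<mu> borel ((+) y)) A = emeasure \<mu> A"
    using haar A by (simp add: emeasure_distr left_haar_measure_def)
qed simp

lemma nn_integral_left:
  assumes [measurable]: "f \<in> borel_measurable borel"
  shows "(\<integral>\<^sup>+x. f (y + x) \<partial>\<mu>) = (\<integral>\<^sup>+x. f x \<partial>\<mu>)"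
  using nn_integral_distr[of "(+) y" \<mu> borel f] by (simp add: distr_left)

text \<open>
  Uniqueness of Haar measure: evaluate \<open>\<integral>\<integral> g (- x) f (y + x)\<close>, with \<open>x\<close> integrated by \<open>\<mu>\<close> and \<open>y\<close>
  by the explicit measure, in both orders. One order uses that the explicit measure is
  relatively right invariant, the other that both measures are left invariant.
\<close>

lemma haar_unique:
  obtains k where "0 < k"
    "\<And>f. f \<in> borel_measurable borel \<Longrightarrow> (\<integral>\<^sup>+x. f x \<partial>\<mu>) = ennreal k * (\<integral>\<^sup>+x. f x \<partial>affine_measure)"
proof -
  let ?\<nu> = affine_measure
  interpret \<nu>: sigma_finite_measure ?\<nu> by (rule sigma_finite_affine_measure)
  interpret P: pair_sigma_finite \<mu> ?\<nu> ..
  define g :: "affine_group \<Rightarrow> ennreal" where "g = indicator (box_set 1)"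
  have [measurable]: "g \<in> borel_measurable borel"
    unfolding g_def by measurable
  define G where "G = (\<integral>\<^sup>+y. g y \<partial>?\<nu>)"
  define C where "C = (\<integral>\<^sup>+x. g (- x) * ennreal (exp (log_scale x)) \<partial>\<mu>)"
  have eq: "(\<integral>\<^sup>+x. f x \<partial>\<mu>) * G = C * (\<integral>\<^sup>+x. f x \<partial>?\<nu>)"
    if [measurable]: "f \<in> borel_measurable borel" for f
  proof -
    have "C * (\<integral>\<^sup>+x. f x \<partial>?\<nu>) = (\<integral>\<^sup>+x. (\<integral>\<^sup>+y. g (- x) * f (y + x) \<partial>?\<nu>) \<partial>\<mu>)"
      unfolding C_def
      by (subst nn_integral_multc[symmetric])
        (auto intro!: nn_integral_cong simp: nn_integral_cmult affine_measure_right mult.assoc)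
    also have "\<dots> = (\<integral>\<^sup>+y. (\<integral>\<^sup>+x. g (- x) * f (y + x) \<partial>\<mu>) \<partial>?\<nu>)"
      by (rule P.Fubini'[symmetric]) measurable
    also have "\<dots> = (\<integral>\<^sup>+y. (\<integral>\<^sup>+x. g (- x + y) * f x \<partial>\<mu>) \<partial>?\<nu>)"
    proof (rule nn_integral_cong)
      fix y
      show "(\<integral>\<^sup>+x. g (- x) * f (y + x) \<partial>\<mu>) = (\<integral>\<^sup>+x. g (- x + y) * f x \<partial>\<mu>)"
        using nn_integral_left[of "\<lambda>x. g (- x + y) * f x" y]
        by (simp add: minus_add add.assoc)
    qed
    also have "\<dots> = (\<integral>\<^sup>+x. (\<integral>\<^sup>+y. g (- x + y) * f x \<partial>?\<nu>) \<partial>\<mu>)"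
      by (rule P.Fubini') measurable
    also have "\<dots> = (\<integral>\<^sup>+x. f x * G \<partial>\<mu>)"
      by (intro nn_integral_cong, subst nn_integral_multc)
        (auto simp: affine_measure_left G_def mult.commute)
    also have "\<dots> = (\<integral>\<^sup>+x. f x \<partial>\<mu>) * G"
      by (rule nn_integral_multc) auto
    finally show ?thesis by simp
  qed
  have G: "0 < G" "G < \<infinity>"
  proof -
    have "G = emeasure ?\<nu> (box_set 1)"
      by (simp add: G_def g_def)
    moreover have "0 < emeasure ?\<nu> (box_set 1)"
      by (rule emeasure_affine_measure_pos[of _ "- 1" 1 "- 1" 1]) (auto simp: box_set_def)
    ultimately show "0 < G" "G < \<infinity>"
      using emeasure_affine_measure_box_less_top[of 1] by simp_all
  qed
  have "C \<le> (\<integral>\<^sup>+x. ennreal (exp 1) * indicator (box_set (exp 1)) x \<partial>\<mu>)"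
    unfolding C_def
  proof (intro nn_integral_mono)
    fix x
    show "g (- x) * ennreal (exp (log_scale x)) \<le> ennreal (exp 1) * indicator (box_set (exp 1)) x"
    proof (cases "- x \<in> box_set 1")
      case True
      then have l: "\<bar>log_scale x\<bar> \<le> 1" and "\<bar>exp (- log_scale x) * shift x\<bar> \<le> 1"
        by (auto simp: box_set_def shift_simps)
      then have "exp (log_scale x) * (exp (- log_scale x) * \<bar>shift x\<bar>) \<le> exp (log_scale x) * 1"
        by (intro mult_left_mono) (auto simp: abs_mult)
      then have "\<bar>shift x\<bar> \<le> exp (log_scale x)"
        by (simp flip: mult.assoc exp_add)
      also have "\<dots> \<le> exp 1" using l by simp
      finally have "\<bar>shift x\<bar> \<le> exp 1" .
      moreover have "\<bar>log_scale x\<bar> \<le> exp 1"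
        using l exp_ge_add_one_self[of 1] by linarith
      ultimately show ?thesis
        using l True by (simp add: g_def box_set_def)
    qed (simp add: g_def)
  qed
  also have "\<dots> < \<infinity>"
    using emeasure_box_less_top[of "exp 1"]
    by (simp add: nn_integral_cmult_indicator ennreal_mult_less_top)
  finally have C: "C < \<infinity>" .
  define k where "k = enn2real (C / G)"
  have k: "ennreal k = C / G"
    using C G unfolding k_def
    by (cases C; cases G) (auto simp: divide_ennreal ennreal_zero_less_divide)
  have *: "(\<integral>\<^sup>+x. f x \<partial>\<mu>) = ennreal k * (\<integral>\<^sup>+x. f x \<partial>?\<nu>)" if "f \<in> borel_measurable borel" for f
  proof -
    have "(\<integral>\<^sup>+x. f x \<partial>\<mu>) = (\<integral>\<^sup>+x. f x \<partial>\<mu>) * G / G"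
      using G by (simp add: ennreal_mult_divide_eq)
    also have "\<dots> = ennreal k * (\<integral>\<^sup>+x. f x \<partial>?\<nu>)"
      unfolding eq[OF that] by (simp add: k ennreal_times_divide mult.commute)
    finally show ?thesis .
  qed
  have "k \<noteq> 0"
  proof
    assume "k = 0"
    then have "emeasure \<mu> UNIV = 0"
      using *[of "\<lambda>x. 1"] by simp
    with haar show False
      by (simp add: left_haar_measure_def)
  qed
  then have "0 < k"
    by (simp add: k_def less_le)
  with * that show ?thesis by blast
qed

lemma nn_integral_right:
  assumes "f \<in> borel_measurable borel"
  shows "(\<integral>\<^sup>+x. f (x + y) \<partial>\<mu>) = ennreal (exp (log_scale y)) * (\<integral>\<^sup>+x. f x \<partial>\<mu>)"
proof -
  obtain k where "\<And>f. f \<in> borel_measurable borel \<Longrightarrow>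
      (\<integral>\<^sup>+x. f x \<partial>\<mu>) = ennreal k * (\<integral>\<^sup>+x. f x \<partial>affine_measure)"
    using haar_unique by blast
  with assms show ?thesis
    by (simp add: affine_measure_right mult_ac)
qed

lemma nn_integral_uminus:
  assumes "f \<in> borel_measurable borel"
  shows "(\<integral>\<^sup>+x. f (- x) \<partial>\<mu>) = (\<integral>\<^sup>+x. ennreal (exp (log_scale x)) * f x \<partial>\<mu>)"
proof -
  obtain k where "\<And>f. f \<in> borel_measurable borel \<Longrightarrow>
      (\<integral>\<^sup>+x. f x \<partial>\<mu>) = ennreal k * (\<integral>\<^sup>+x. f x \<partial>affine_measure)"
    using haar_unique by blast
  with assms show ?thesis
    by (simp add: affine_measure_uminus)
qed

lemma emeasure_pos:
  assumes "A \<in> sets borel" "a < b" "c < d"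
    and "\<And>s t. a < s \<Longrightarrow> s < b \<Longrightarrow> c < t \<Longrightarrow> t < d \<Longrightarrow> aff s t \<in> A"
  shows "0 < emeasure \<mu> A"
proof -
  obtain k where k: "0 < k" "\<And>f. f \<in> borel_measurable borel \<Longrightarrow>
      (\<integral>\<^sup>+x. f x \<partial>\<mu>) = ennreal k * (\<integral>\<^sup>+x. f x \<partial>affine_measure)"
    using haar_unique by blast
  then have "emeasure \<mu> A = ennreal k * emeasure affine_measure A"
    using k(2)[of "indicator A"] assms(1) by simp
  with k(1) emeasure_affine_measure_pos[of A a b c d] assms show ?thesis
    by (simp add: ennreal_zero_less_mult_iff)
qed

lemma emeasure_right:
  assumes A [measurable]: "A \<in> sets borel"
  shows "emeasure \<mu> ((\<lambda>y. y + x) ` A) = ennreal (exp (- log_scale x)) * emeasure \<mu> A"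
proof -
  have im: "(\<lambda>y. y + x) ` A = (\<lambda>z. z + - x) -` A"
  proof (intro equalityI subsetI)
    fix z assume "z \<in> (\<lambda>z. z + - x) -` A"
    then show "z \<in> (\<lambda>y. y + x) ` A"
      by (intro image_eqI[of _ _ "z + - x"]) (auto simp: add.assoc)
  qed (auto simp: add.assoc)
  have "(\<lambda>z. z + - x) \<in> borel \<rightarrow>\<^sub>M borel" by measurable
  from measurable_sets[OF this A] have pre: "(\<lambda>z. z + - x) -` A \<in> sets borel"
    by (simp only: space_borel Int_UNIV_right)
  have "emeasure \<mu> ((\<lambda>z. z + - x) -` A) = (\<integral>\<^sup>+z. indicator A (z + - x) \<partial>\<mu>)"
    using pre by (subst nn_integral_indicator[symmetric])
      (auto simp only: sets_haar indicator_vimage intro!: nn_integral_cong)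
  also have "\<dots> = ennreal (exp (- log_scale x)) * emeasure \<mu> A"
    by (subst nn_integral_right) auto
  finally show ?thesis unfolding im .
qed

lemma modular_function_haar: "modular_function \<mu> x = exp (- log_scale x)"
  unfolding modular_function_def
proof (rule the_equality, intro conjI ballI emeasure_right)
  fix c
  assume "0 < c \<and> (\<forall>A\<in>sets borel. emeasure \<mu> ((\<lambda>y. y + x) ` A) = ennreal c * emeasure \<mu> A)"
  then have c: "0 < c" "ennreal c * emeasure \<mu> (box_set 1) =
      ennreal (exp (- log_scale x)) * emeasure \<mu> (box_set 1)"
    using emeasure_right[OF measurable_box_set[of 1], of x] measurable_box_set[of 1] by auto
  obtain m where m: "emeasure \<mu> (box_set 1) = ennreal m" "0 \<le> m"
    using emeasure_box_less_top[of 1] by (cases "emeasure \<mu> (box_set 1)") auto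
  have "0 < emeasure \<mu> (box_set 1)"
    by (rule emeasure_pos[of _ "- 1" 1 "- 1" 1]) (auto simp: box_set_def)
  with m have "0 < m" by simp
  with c m show "c = exp (- log_scale x)"
    by (simp flip: ennreal_mult)
qed simp_all

lemma AE_uminus:
  assumes "AE x in \<mu>. P x"
  shows "AE x in \<mu>. P (- x)"
proof -
  obtain N where N: "N \<in> null_sets \<mu>" "{x. \<not> P x} \<subseteq> N"
    using assms by (auto simp: eventually_ae_filter)
  then have [measurable]: "N \<in> sets borel" by (auto dest: null_setsD2)
  have "AE x in \<mu>. ennreal (exp (log_scale x)) * indicator N x = 0"
    using AE_not_in[OF N(1)] by eventually_elim simp
  then have "(\<integral>\<^sup>+x. indicator N (- x) \<partial>\<mu>) = 0"
    by (subst nn_integral_uminus) (auto simp: nn_integral_0_iff_AE)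
  then have "AE x in \<mu>. indicator N (- x) = (0::ennreal)"
    by (subst (asm) nn_integral_0_iff_AE) auto
  then show ?thesis
    by eventually_elim (use N(2) in \<open>auto simp: indicator_def split: if_splits\<close>)
qed

lemma AE_plus_left:
  assumes "AE x in \<mu>. P x"
  shows "AE x in \<mu>. P (y + x)"
proof -
  obtain N where N: "N \<in> null_sets \<mu>" "{x. \<not> P x} \<subseteq> N"
    using assms by (auto simp: eventually_ae_filter)
  then have [measurable]: "N \<in> sets borel" by (auto dest: null_setsD2)
  have "(\<integral>\<^sup>+x. indicator N (y + x) \<partial>\<mu>) = emeasure \<mu> N"
    by (subst nn_integral_left) auto
  then have "AE x in \<mu>. indicator N (y + x) = (0::ennreal)"
    using N(1) by (simp add: null_setsD1 nn_integral_0_iff_AE)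
  then show ?thesis
    by eventually_elim (use N(2) in \<open>auto simp: indicator_def split: if_splits\<close>)
qed

lemma integral_left:
  fixes f :: "affine_group \<Rightarrow> 'b::{banach, second_countable_topology}"
  assumes [measurable]: "f \<in> borel_measurable borel"
  shows "(\<integral>x. f (y + x) \<partial>\<mu>) = (\<integral>x. f x \<partial>\<mu>)"
  using integral_distr[of "(+) y" \<mu> borel f] by (simp add: distr_left)

lemma integral_right:
  fixes f :: "affine_group \<Rightarrow> 'b::{banach, second_countable_topology}"
  assumes [measurable]: "f \<in> borel_measurable borel"
  shows "(\<integral>x. f (x + y) \<partial>\<mu>) = exp (log_scale y) *\<^sub>R (\<integral>x. f x \<partial>\<mu>)"
proof -
  have "distr \<mu> borel (\<lambda>x. x + y) = density \<mu> (\<lambda>x. ennreal (exp (log_scale y)))"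
  proof (rule measure_eqI)
    fix A assume "A \<in> sets (distr \<mu> borel (\<lambda>x. x + y))"
    then have A [measurable]: "A \<in> sets borel" by simp
    show "emeasure (distr \<mu> borel (\<lambda>x. x + y)) A =
        emeasure (density \<mu> (\<lambda>x. ennreal (exp (log_scale y)))) A"
      using nn_integral_right[of "indicator A" y]
        nn_integral_distr[of "\<lambda>x. x + y" \<mu> borel "indicator A"]
      by (simp add: emeasure_density nn_integral_cmult)
  qed simp
  then show ?thesis
    using integral_distr[of "\<lambda>x. x + y" \<mu> borel f]
    by (simp add: integral_density)
qed

lemma integral_uminus:
  fixes f :: "affine_group \<Rightarrow> 'b::{banach, second_countable_topology}"
  assumes [measurable]: "f \<in> borel_measurable borel"
  shows "(\<integral>x. f (- x) \<partial>\<mu>) = (\<integral>x. exp (log_scale x) *\<^sub>R f x \<partial>\<mu>)"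
proof -
  have "distr \<mu> borel uminus = density \<mu> (\<lambda>x. ennreal (exp (log_scale x)))"
  proof (rule measure_eqI)
    fix A assume "A \<in> sets (distr \<mu> borel uminus)"
    then have A [measurable]: "A \<in> sets borel" by simp
    show "emeasure (distr \<mu> borel uminus) A =
        emeasure (density \<mu> (\<lambda>x. ennreal (exp (log_scale x)))) A"
      using nn_integral_uminus[of "indicator A"]
        nn_integral_distr[of uminus \<mu> borel "indicator A"]
      by (simp add: emeasure_density)
  qed simp
  then show ?thesis
    using integral_distr[of uminus \<mu> borel f]
    by (simp add: integral_density)
qed

end

section \<open>Kernels carried by a strip\<close>

definition profile :: "(real \<Rightarrow> real) \<Rightarrow> bool" where
  "profile p \<longleftrightarrow> p \<in> borel_measurable borel \<and>
    (\<exists>R. \<forall>s. \<bar>p s\<bar> \<le> R \<and> (p s \<noteq> 0 \<longrightarrow> \<bar>s\<bar> \<le> R))"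

text \<open>
  An element \<open>f\<close> of the algebra can be seen as the operator kernel taking \<open>z\<close> to \<open>x + z\<close> with
  weight \<open>f x z\<close>. In this picture \<open>strip_kernel p\<close> is supported where \<open>z\<close> and \<open>x + z\<close> both have shift
  in \<open>{-1<..<1}\<close>, and depends on the two shifts through a function of rank one.
\<close>

definition strip_kernel :: "(real \<Rightarrow> real) \<Rightarrow> affine_group \<Rightarrow> affine_group ruc" where
  "strip_kernel p x = p (log_scale x) *\<^sub>R (bump * translate_ruc (- x) bump)"

lemma profile_measurable: "profile p \<Longrightarrow> p \<in> borel_measurable borel"
  by (simp add: profile_def)

lemma profile_bound:
  assumes "profile p"
  obtains R where "0 \<le> R" "\<And>s. \<bar>p s\<bar> \<le> R" "\<And>s. p s \<noteq> 0 \<Longrightarrow> \<bar>s\<bar> \<le> R"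
proof -
  obtain R where R: "\<And>s. \<bar>p s\<bar> \<le> R" "\<And>s. p s \<noteq> 0 \<Longrightarrow> \<bar>s\<bar> \<le> R"
    using assms unfolding profile_def by blast
  moreover have "0 \<le> R"
    using R(1)[of 0] by simp
  ultimately show ?thesis
    using that by blast
qed

lemma profile_shift:
  assumes "profile p"
  shows "profile (\<lambda>s. p (s + r))"
proof -
  obtain R where R: "0 \<le> R" "\<And>s. \<bar>p s\<bar> \<le> R" "\<And>s. p s \<noteq> 0 \<Longrightarrow> \<bar>s\<bar> \<le> R"
    using profile_bound[OF assms] by blast
  have "\<bar>p (s + r)\<bar> \<le> R + \<bar>r\<bar> \<and> (p (s + r) \<noteq> 0 \<longrightarrow> \<bar>s\<bar> \<le> R + \<bar>r\<bar>)" for s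
    using R(2,3)[of "s + r"] by linarith
  moreover have "(\<lambda>s. p (s + r)) \<in> borel_measurable borel"
    using profile_measurable[OF assms] by measurable
  ultimately show ?thesis
    unfolding profile_def by blast
qed

text \<open>
  The factor is the value of the modular function at \<open>- x\<close>, where \<open>s\<close> is the logarithmic scale
  of \<open>x\<close>.
\<close>

definition profile_star :: "(real \<Rightarrow> real) \<Rightarrow> real \<Rightarrow> real" where
  "profile_star p s = exp s * p (- s)"

lemma profile_profile_star:
  assumes "profile p"
  shows "profile (profile_star p)"
proof -
  obtain R where R: "0 \<le> R" "\<And>s. \<bar>p s\<bar> \<le> R" "\<And>s. p s \<noteq> 0 \<Longrightarrow> \<bar>s\<bar> \<le> R"
    using profile_bound[OF assms] by blast
  have "\<bar>profile_star p s\<bar> \<le> exp R * R + R \<and> (profile_star p s \<noteq> 0 \<longrightarrow> \<bar>s\<bar> \<le> exp R * R + R)" for s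
  proof (cases "p (- s) = 0")
    case False
    then have s: "\<bar>s\<bar> \<le> R"
      using R(3)[of "- s"] by simp
    then have "exp s * \<bar>p (- s)\<bar> \<le> exp R * R"
      using R(2) by (intro mult_mono) auto
    with R(1) s show ?thesis
      by (simp add: profile_star_def abs_mult add_increasing add_increasing2)
  qed (use R(1) in \<open>simp add: profile_star_def\<close>)
  moreover have "profile_star p \<in> borel_measurable borel"
    using profile_measurable[OF assms] unfolding profile_star_def by measurable
  ultimately show ?thesis
    unfolding profile_def by blast
qed

text \<open>
  The sign change and the factor \<open>2\<close> are chosen so that the integral is negative with respect to
  \<open>ds\<close>, but positive with respect to \<open>exp (- s) ds\<close>, which gives more weight to negative
  arguments.
\<close>

definition step :: "real \<Rightarrow> real" where
  "step s = indicator {-1<..0} s - 2 * indicator {0<..1} s"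

lemma profile_indicator:
  assumes "A \<in> sets borel" "\<And>s. s \<in> A \<Longrightarrow> \<bar>s\<bar> \<le> R"
  shows "profile (indicator A)"
  unfolding profile_def
  using assms by (intro conjI exI[of _ "max 1 R"]) (auto simp: indicator_def le_max_iff_disj)

lemma profile_step: "profile step"
  unfolding profile_def step_def[abs_def]
  by (intro conjI exI[of _ 2]) (measurable, auto simp: indicator_def)

lemma ruc_at_strip_kernel:
  "ruc_at z (strip_kernel p x) = p (log_scale x) * (tent (shift z) * tent (shift (x + z)))"
  by (simp add: strip_kernel_def scaleR_conv_of_real)

text \<open>
  The integrand of the twisted product with a strip kernel on the left: one translate of the bump
  function does not depend on the variable of integration \<open>y\<close>.
\<close>

lemma translate_strip_kernel:
  "translate_ruc y (strip_kernel p (x + y)) * f =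
    p (log_scale x + log_scale y) *\<^sub>R (translate_ruc (- x) bump * (translate_ruc y bump * f))"
proof (rule ruc_eqI)
  fix z
  have "x + y + (- y + z) = x + z"
    by (simp flip: add.assoc)
  then show "ruc_at z (translate_ruc y (strip_kernel p (x + y)) * f) = ruc_at z
      (p (log_scale x + log_scale y) *\<^sub>R (translate_ruc (- x) bump * (translate_ruc y bump * f)))"
    by (simp add: ruc_at_strip_kernel scaleR_conv_of_real)
qed

lemma continuous_on_translate_bump_ruc [continuous_intros]:
  "continuous_on UNIV f \<Longrightarrow> continuous_on UNIV (\<lambda>y. translate_ruc (f y) bump)"
  by (rule continuous_on_compose2[OF continuous_on_translate_ruc]) auto

section \<open>Classes of functions\<close>

lemma AE_representative: "AE x in M. representative (ae_class M f) x = f x"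
proof -
  have "f \<in> ae_class M f" by (simp add: ae_class_def)
  then have "representative (ae_class M f) \<in> ae_class M f"
    unfolding representative_def by (rule someI[of "\<lambda>h. h \<in> ae_class M f"])
  then show ?thesis by (simp add: ae_class_def)
qed

lemma ae_class_eq_iff: "ae_class M f = ae_class M g \<longleftrightarrow> (AE x in M. f x = g x)"
proof
  assume "ae_class M f = ae_class M g"
  then have "f \<in> ae_class M g" by (metis (mono_tags) ae_class_def AE_I2 mem_Collect_eq)
  then show "AE x in M. f x = g x" by (simp add: ae_class_def)
next
  assume eq: "AE x in M. f x = g x"
  have "(AE x in M. h x = f x) \<longleftrightarrow> (AE x in M. h x = g x)" for h
    using eq by (auto elim: eventually_elim2)
  then show "ae_class M f = ae_class M g"
    by (simp add: ae_class_def)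
qed

lemma sa_carrier_twisted_L1E:
  assumes "F \<in> sa_carrier (twisted_L1 \<mu>)"
  obtains f where "F = ae_class \<mu> f" "strongly_measurable \<mu> f"
    "(\<integral>\<^sup>+x. ennreal (norm (f x)) \<partial>\<mu>) < \<infinity>"
proof -
  obtain g where g: "F = ae_class \<mu> g" "strongly_integrable \<mu> g"
    using assms by (auto simp: twisted_L1_def)
  obtain f where "strongly_measurable \<mu> f" "AE x in \<mu>. g x = f x"
    "(\<integral>\<^sup>+x. ennreal (norm (f x)) \<partial>\<mu>) < \<infinity>"
    using strongly_integrable_imp_strongly_measurable[OF g(2)] by blast
  then show ?thesis
    using that g(1) by (simp add: ae_class_eq_iff)
qed

context affine_haar
begin

lemma nn_integral_box_bounded:
  fixes g :: "affine_group \<Rightarrow> real"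
  assumes "\<And>x. g x \<le> R * indicator (box_set r) x" "0 \<le> R"
  shows "(\<integral>\<^sup>+x. ennreal (g x) \<partial>\<mu>) < \<infinity>"
proof -
  have "(\<integral>\<^sup>+x. ennreal (g x) \<partial>\<mu>) \<le> (\<integral>\<^sup>+x. ennreal R * indicator (box_set r) x \<partial>\<mu>)"
  proof (intro nn_integral_mono)
    fix x
    show "ennreal (g x) \<le> ennreal R * indicator (box_set r) x"
      using ennreal_leI[OF assms(1)[of x]] assms(2) by (simp add: ennreal_mult ennreal_indicator)
  qed
  also have "\<dots> < \<infinity>"
    using emeasure_box_less_top[of r]
    by (simp add: nn_integral_cmult_indicator ennreal_mult_less_top)
  finally show ?thesis .
qed

lemma strongly_measurable_log_scale:
  assumes "p \<in> borel_measurable borel"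
  shows "strongly_measurable \<mu> (\<lambda>x. p (log_scale x) :: real)"
proof (rule strongly_measurable_borel)
  show "(\<lambda>x. p (log_scale x)) \<in> borel_measurable \<mu>"
    using assms by measurable
qed

lemma strongly_measurable_strip_kernel:
  assumes "profile p"
  shows "strongly_measurable \<mu> (strip_kernel p)"
  unfolding strip_kernel_def[abs_def]
  by (intro strongly_measurable_scaleR strongly_measurable_log_scale profile_measurable assms
      strongly_measurable_continuous_affine_group continuous_intros sets_haar)

text \<open>
  If \<open>z\<close> and \<open>x + z\<close> lie in the strip, then the shift of \<open>x\<close> is at most \<open>1 + exp (log_scale x)\<close>. Hence
  a strip kernel is supported in a compact set.
\<close>

lemma norm_strip_kernel_integrable:
  assumes "profile p"
  shows "(\<integral>\<^sup>+x. ennreal (norm (strip_kernel p x)) \<partial>\<mu>) < \<infinity>"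
proof -
  obtain R where R: "0 \<le> R" "\<And>s. \<bar>p s\<bar> \<le> R" "\<And>s. p s \<noteq> 0 \<Longrightarrow> \<bar>s\<bar> \<le> R"
    using profile_bound[OF assms] by blast
  let ?r = "1 + exp R + R"
  have "norm (strip_kernel p x) \<le> R * indicator (box_set ?r) x" for x
  proof (rule norm_ruc_leI)
    fix z
    show "norm (ruc_at z (strip_kernel p x)) \<le> R * indicator (box_set ?r) x"
    proof (cases "p (log_scale x) * (tent (shift z) * tent (shift (x + z))) = 0")
      case True
      then have "ruc_at z (strip_kernel p x) = 0"
        by (auto simp: ruc_at_strip_kernel)
      then show ?thesis
        using R(1) by simp
    next
      case False
      have p: "\<bar>p (log_scale x)\<bar> \<le> R" "\<bar>log_scale x\<bar> \<le> R"
        using False R(2,3)[of "log_scale x"] by auto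
      have "\<bar>shift z\<bar> < 1" "\<bar>exp (log_scale x) * shift z + shift x\<bar> < 1"
        using False tent_eq_0[of "shift z"] tent_eq_0[of "shift (x + z)"]
        by (auto simp: shift_simps not_less[symmetric])
      moreover from this(1) have "\<bar>exp (log_scale x) * shift z\<bar> \<le> exp (log_scale x) * 1"
        unfolding abs_mult by (intro mult_mono) auto
      ultimately have "\<bar>shift x\<bar> \<le> 1 + exp (log_scale x)"
        by linarith
      also have "\<dots> \<le> ?r"
        using p(2) R(1) by (auto intro!: add_increasing2)
      finally have "x \<in> box_set ?r"
        using p(2) by (simp add: box_set_def add_increasing)
      moreover have "tent (shift z) * tent (shift (x + z)) \<le> 1 * 1"
        by (intro mult_mono tent_bounds) auto
      then have "\<bar>p (log_scale x)\<bar> * (tent (shift z) * tent (shift (x + z))) \<le> R * 1"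
        using p(1) R(1) by (intro mult_mono) (auto simp: tent_bounds)
      ultimately show ?thesis
        by (simp add: ruc_at_strip_kernel norm_mult tent_bounds)
    qed
  qed
  then show ?thesis
    using R(1) by (rule nn_integral_box_bounded)
qed

lemma strongly_integrable_strip_kernel: "profile p \<Longrightarrow> strongly_integrable \<mu> (strip_kernel p)"
  by (intro strongly_integrableI strongly_measurable_strip_kernel norm_strip_kernel_integrable)

lemma twisted_conv_cong_AE:
  assumes "AE x in \<mu>. h x = h' x" "AE x in \<mu>. f x = f' x"
  shows "twisted_conv \<mu> h f x = twisted_conv \<mu> h' f' x"
  unfolding twisted_conv_def
proof (rule strong_integral_cong_AE)
  show "AE y in \<mu>. translate_ruc y (h (x + y)) * f (- y) = translate_ruc y (h' (x + y)) * f' (- y)"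
    using AE_plus_left[OF assms(1), of x] AE_uminus[OF assms(2)] by eventually_elim simp
qed

text \<open>
  The function \<open>c (- y)\<close> need not be integrable, because the group is not unimodular. The profile
  restricts \<open>y\<close> to bounded scales, where the modular function is bounded, so that the
  convolution integral converges for every \<open>x\<close>.
\<close>

lemma ruc_at_twisted_conv_strip_kernel:
  assumes p: "profile p" and c: "strongly_measurable \<mu> c" "(\<integral>\<^sup>+x. ennreal (norm (c x)) \<partial>\<mu>) < \<infinity>"
  shows "ruc_at z (twisted_conv \<mu> (strip_kernel p) c x) = tent (shift (x + z)) *\<^sub>R
    (\<integral>y. (p (log_scale x + log_scale y) * tent (shift (- y + z))) *\<^sub>R ruc_at z (c (- y)) \<partial>\<mu>)"
proof -
  let ?w = "\<lambda>y. p (log_scale x + log_scale y) *\<^sub>R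
    (translate_ruc (- x) bump * (translate_ruc y bump * c (- y)))"
  obtain R where R: "0 \<le> R" "\<And>s. \<bar>p s\<bar> \<le> R" "\<And>s. p s \<noteq> 0 \<Longrightarrow> \<bar>s\<bar> \<le> R"
    using profile_bound[OF p] by blast
  note [measurable] = profile_measurable[OF p] borel_measurable_norm_strongly[OF c(1)]
  have "strongly_measurable \<mu> ?w"
  proof (intro strongly_measurable_scaleR strongly_measurable_mult)
    show "strongly_measurable \<mu> (\<lambda>y. p (log_scale x + log_scale y))"
      by (rule strongly_measurable_borel) measurable
    show "strongly_measurable \<mu> (\<lambda>y. c (- y))"
      by (rule strongly_measurable_compose[OF c(1)]) measurable
  qed (intro strongly_measurable_continuous_affine_group continuous_intros sets_haar)+
  moreover have "(\<integral>\<^sup>+y. ennreal (norm (?w y)) \<partial>\<mu>) < \<infinity>"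
  proof -
    have "norm (?w y) \<le> \<bar>p (log_scale x + log_scale y)\<bar> * norm (c (- y))" for y
    proof -
      have "norm (translate_ruc (- x) bump * (translate_ruc y bump * c (- y))) \<le>
          1 * (1 * norm (c (- y)))"
        by (intro order_trans[OF norm_mult_ineq] mult_mono norm_translate_bump_le) auto
      then show ?thesis by (simp add: mult_left_mono)
    qed
    then have "(\<integral>\<^sup>+y. ennreal (norm (?w y)) \<partial>\<mu>) \<le>
        (\<integral>\<^sup>+y. ennreal (\<bar>p (log_scale x - log_scale (- y))\<bar> * norm (c (- y))) \<partial>\<mu>)"
      by (intro nn_integral_mono ennreal_leI) simp
    also have "\<dots> = (\<integral>\<^sup>+y. ennreal (exp (log_scale y)) *
        ennreal (\<bar>p (log_scale x - log_scale y)\<bar> * norm (c y)) \<partial>\<mu>)"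
      by (rule nn_integral_uminus) measurable
    also have "\<dots> \<le> (\<integral>\<^sup>+y. ennreal (exp (R + log_scale x) * R) * ennreal (norm (c y)) \<partial>\<mu>)"
    proof (intro nn_integral_mono)
      fix y
      have "exp (log_scale y) * \<bar>p (log_scale x - log_scale y)\<bar> \<le> exp (R + log_scale x) * R"
      proof (cases "p (log_scale x - log_scale y) = 0")
        case False
        then show ?thesis
          using R(2,3)[of "log_scale x - log_scale y"] by (intro mult_mono) auto
      qed (use R(1) in simp)
      then have "exp (log_scale y) * \<bar>p (log_scale x - log_scale y)\<bar> * norm (c y) \<le>
          exp (R + log_scale x) * R * norm (c y)"
        by (intro mult_right_mono) auto
      then show "ennreal (exp (log_scale y)) *
          ennreal (\<bar>p (log_scale x - log_scale y)\<bar> * norm (c y)) \<le>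
          ennreal (exp (R + log_scale x) * R) * ennreal (norm (c y))"
        using R(1) by (simp add: mult.assoc flip: ennreal_mult)
    qed
    also have "\<dots> < \<infinity>"
      using c(2) by (simp add: nn_integral_cmult ennreal_mult_less_top)
    finally show ?thesis .
  qed
  ultimately have "ruc_at z (strong_integral \<mu> ?w) = (\<integral>y. ruc_at z (?w y) \<partial>\<mu>)"
    by (intro strong_integral_functional bounded_linear_ruc_at) auto
  also have "(\<lambda>y. ruc_at z (?w y)) = (\<lambda>y. tent (shift (x + z)) *\<^sub>R
      (p (log_scale x + log_scale y) * tent (shift (- y + z))) *\<^sub>R ruc_at z (c (- y)))"
    by (simp add: scaleR_conv_of_real mult_ac)
  also have "(\<integral>y. tent (shift (x + z)) *\<^sub>R
      (p (log_scale x + log_scale y) * tent (shift (- y + z))) *\<^sub>R ruc_at z (c (- y)) \<partial>\<mu>) =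
      tent (shift (x + z)) *\<^sub>R
      (\<integral>y. (p (log_scale x + log_scale y) * tent (shift (- y + z))) *\<^sub>R ruc_at z (c (- y)) \<partial>\<mu>)"
    by (rule integral_scaleR_right)
  finally show ?thesis
    by (simp add: twisted_conv_def translate_strip_kernel)
qed


section \<open>The eigenfunctional\<close>

definition strip_mean :: "(real \<Rightarrow> real) \<Rightarrow> real" where
  "strip_mean p = (\<integral>x. (tent (shift x))\<^sup>2 * p (log_scale x) \<partial>\<mu>)"

definition strip_functional :: "(affine_group \<Rightarrow> affine_group ruc) \<Rightarrow> complex" where
  "strip_functional c = (\<integral>x. tent (shift x) *\<^sub>R ruc_at 0 (c x) \<partial>\<mu>)"

lemma nn_integral_tent_profile:
  assumes "profile p"
  shows "(\<integral>\<^sup>+x. ennreal ((tent (shift x))\<^sup>2 * \<bar>p (log_scale x)\<bar>) \<partial>\<mu>) < \<infinity>"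
proof -
  obtain R where R: "0 \<le> R" "\<And>s. \<bar>p s\<bar> \<le> R" "\<And>s. p s \<noteq> 0 \<Longrightarrow> \<bar>s\<bar> \<le> R"
    using profile_bound[OF assms] by blast
  have "(tent (shift x))\<^sup>2 * \<bar>p (log_scale x)\<bar> \<le> R * indicator (box_set (max R 1)) x" for x
  proof (cases "tent (shift x) = 0 \<or> p (log_scale x) = 0")
    case True
    with R(1) show ?thesis by auto
  next
    case False
    then have "\<bar>log_scale x\<bar> \<le> R" "\<not> 1 \<le> \<bar>shift x\<bar>"
      using R(3)[of "log_scale x"] tent_eq_0[of "shift x"] by blast+
    then have "x \<in> box_set (max R 1)"
      by (auto simp: box_set_def)
    moreover have "(tent (shift x))\<^sup>2 * \<bar>p (log_scale x)\<bar> \<le> 1 * R"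
      by (intro mult_mono power_le_one tent_bounds R(2)) auto
    ultimately show ?thesis by simp
  qed
  then show ?thesis
    using R(1) by (rule nn_integral_box_bounded)
qed

lemma integrable_mean:
  assumes "profile p"
  shows "integrable \<mu> (\<lambda>x. (tent (shift x))\<^sup>2 * p (log_scale x))"
proof (rule integrableI_bounded)
  show "(\<lambda>x. (tent (shift x))\<^sup>2 * p (log_scale x)) \<in> borel_measurable \<mu>"
    using profile_measurable[OF assms] by measurable
  show "(\<integral>\<^sup>+x. ennreal (norm ((tent (shift x))\<^sup>2 * p (log_scale x))) \<partial>\<mu>) < \<infinity>"
    using nn_integral_tent_profile[OF assms] by (simp add: abs_mult)
qed

text \<open>Right multiplication by \<open>aff s 0\<close> dilates the group without changing the shift.\<close>

lemma strip_mean_shift: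
  assumes [measurable]: "p \<in> borel_measurable borel"
  shows "strip_mean (\<lambda>s. p (s + r)) = exp r * strip_mean p"
  using integral_right[of "\<lambda>x. (tent (shift x))\<^sup>2 * p (log_scale x)" "aff r 0"]
  by (simp add: strip_mean_def shift_simps)

lemma borel_measurable_ruc_at:
  assumes "strongly_measurable \<mu> c"
  shows "(\<lambda>x. ruc_at z (c x)) \<in> borel_measurable borel"
  using borel_measurable_strongly_measurable[OF strongly_measurable_continuous[OF assms
      linear_continuous_on[OF bounded_linear_ruc_at]], of z] by simp

lemma integrable_strip_functional:
  assumes c: "strongly_measurable \<mu> c" "(\<integral>\<^sup>+x. ennreal (norm (c x)) \<partial>\<mu>) < \<infinity>"
  shows "integrable \<mu> (\<lambda>x. tent (shift x) *\<^sub>R ruc_at 0 (c x))"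
proof (rule integrableI_bounded)
  note [measurable] = borel_measurable_ruc_at[OF c(1)]
  show "(\<lambda>x. tent (shift x) *\<^sub>R ruc_at 0 (c x)) \<in> borel_measurable \<mu>" by measurable
  have "norm (tent (shift x) *\<^sub>R ruc_at 0 (c x)) \<le> 1 * norm (c x)" for x
    unfolding norm_scaleR
    by (intro mult_mono norm_ruc_at_le) (auto simp: tent_bounds)
  then have "(\<integral>\<^sup>+x. ennreal (norm (tent (shift x) *\<^sub>R ruc_at 0 (c x))) \<partial>\<mu>) \<le>
      (\<integral>\<^sup>+x. ennreal (norm (c x)) \<partial>\<mu>)"
    by (intro nn_integral_mono ennreal_leI) simp
  with c(2) show "(\<integral>\<^sup>+x. ennreal (norm (tent (shift x) *\<^sub>R ruc_at 0 (c x))) \<partial>\<mu>) < \<infinity>"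
    by (rule le_less_trans[rotated])
qed

lemma strip_functional_strip_kernel: "strip_functional (strip_kernel p) = strip_mean p"
proof -
  have "strip_functional (strip_kernel p) =
      (\<integral>x. complex_of_real ((tent (shift x))\<^sup>2 * p (log_scale x)) \<partial>\<mu>)"
    unfolding strip_functional_def
    by (intro Bochner_Integration.integral_cong)
      (simp_all add: ruc_at_strip_kernel shift_simps tent_def scaleR_conv_of_real power2_eq_square)
  then show ?thesis
    by (simp only: integral_complex_of_real strip_mean_def)
qed

text \<open>
  After exchanging the integrals, the integral over \<open>x\<close> of \<open>(tent (shift x))\<^sup>2 * p (log_scale (x + y))\<close>
  is \<open>exp (log_scale y) * strip_mean p\<close>, as only the scale of \<open>x\<close> is moved. This exponential is the
  modular factor that the substitution of \<open>- y\<close> for \<open>y\<close> absorbs.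
\<close>

lemma strip_functional_conv:
  assumes p: "profile p" and c: "strongly_measurable \<mu> c" "(\<integral>\<^sup>+x. ennreal (norm (c x)) \<partial>\<mu>) < \<infinity>"
  shows "integrable \<mu> (\<lambda>x. tent (shift x) *\<^sub>R ruc_at 0 (twisted_conv \<mu> (strip_kernel p) c x))"
    and "strip_functional (twisted_conv \<mu> (strip_kernel p) c) = strip_mean p * strip_functional c"
proof -
  interpret P: pair_sigma_finite \<mu> \<mu> ..
  note [measurable] = profile_measurable[OF p] borel_measurable_ruc_at[OF c(1)]
  define F where "F x = tent (shift x) *\<^sub>R ruc_at 0 (c x)" for x
  have [measurable]: "F \<in> borel_measurable borel"
    unfolding F_def by measurable
  have F: "integrable \<mu> F"
    unfolding F_def using integrable_strip_functional[OF c] .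
  \<comment> \<open>The inversion of y is kept outside of K: it is undone after x has been integrated out.\<close>
  define K where "K x y = ((tent (shift x))\<^sup>2 * p (log_scale (x + - y))) *\<^sub>R F y" for x y
  let ?K = "\<lambda>(x, y). K x (- y)"
  have conv: "tent (shift x) *\<^sub>R ruc_at 0 (twisted_conv \<mu> (strip_kernel p) c x) = (\<integral>y. K x (- y) \<partial>\<mu>)" for x
    unfolding ruc_at_twisted_conv_strip_kernel[OF p c]
    by (simp add: K_def F_def power2_eq_square mult_ac flip: integral_scaleR_right)
  have int: "integrable (\<mu> \<Otimes>\<^sub>M \<mu>) ?K"
  proof (rule integrableI_bounded)
    show "?K \<in> borel_measurable (\<mu> \<Otimes>\<^sub>M \<mu>)"
      unfolding K_def by measurable
    have "(\<integral>\<^sup>+w. ennreal (norm (?K w)) \<partial>(\<mu> \<Otimes>\<^sub>M \<mu>)) = (\<integral>\<^sup>+y. (\<integral>\<^sup>+x. ennreal (norm (K x (- y))) \<partial>\<mu>) \<partial>\<mu>)"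
      by (subst P.nn_integral_snd[symmetric]) (auto simp: K_def)
    also have "\<dots> = (\<integral>\<^sup>+y. ennreal (exp (log_scale y)) * ennreal (norm (F (- y))) *
        (\<integral>\<^sup>+x. ennreal ((tent (shift x))\<^sup>2 * \<bar>p (log_scale x)\<bar>) \<partial>\<mu>) \<partial>\<mu>)"
    proof (rule nn_integral_cong)
      fix y
      have "(\<integral>\<^sup>+x. ennreal (norm (K x (- y))) \<partial>\<mu>) = (\<integral>\<^sup>+x. ennreal (norm (F (- y))) *
          ennreal ((tent (shift (x + aff (log_scale y) 0)))\<^sup>2 *
            \<bar>p (log_scale (x + aff (log_scale y) 0))\<bar>) \<partial>\<mu>)"
        by (intro nn_integral_cong)
          (simp add: K_def shift_simps abs_mult mult_ac flip: ennreal_mult)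
      also have "\<dots> = ennreal (norm (F (- y))) * (\<integral>\<^sup>+x.
          ennreal ((tent (shift (x + aff (log_scale y) 0)))\<^sup>2 *
            \<bar>p (log_scale (x + aff (log_scale y) 0))\<bar>) \<partial>\<mu>)"
        by (rule nn_integral_cmult) measurable
      also have "(\<integral>\<^sup>+x. ennreal ((tent (shift (x + aff (log_scale y) 0)))\<^sup>2 *
            \<bar>p (log_scale (x + aff (log_scale y) 0))\<bar>) \<partial>\<mu>) =
          ennreal (exp (log_scale y)) *
          (\<integral>\<^sup>+x. ennreal ((tent (shift x))\<^sup>2 * \<bar>p (log_scale x)\<bar>) \<partial>\<mu>)"
        using nn_integral_right[of "\<lambda>x. ennreal ((tent (shift x))\<^sup>2 * \<bar>p (log_scale x)\<bar>)"
            "aff (log_scale y) 0"] by simp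
      finally show "(\<integral>\<^sup>+x. ennreal (norm (K x (- y))) \<partial>\<mu>) =
          ennreal (exp (log_scale y)) * ennreal (norm (F (- y))) *
          (\<integral>\<^sup>+x. ennreal ((tent (shift x))\<^sup>2 * \<bar>p (log_scale x)\<bar>) \<partial>\<mu>)"
        by (simp add: mult_ac)
    qed
    also have "\<dots> = (\<integral>\<^sup>+y. ennreal (exp (log_scale y)) * ennreal (norm (F (- y))) \<partial>\<mu>) *
        (\<integral>\<^sup>+x. ennreal ((tent (shift x))\<^sup>2 * \<bar>p (log_scale x)\<bar>) \<partial>\<mu>)"
      by (rule nn_integral_multc) measurable
    also have "(\<integral>\<^sup>+y. ennreal (exp (log_scale y)) * ennreal (norm (F (- y))) \<partial>\<mu>) =
        (\<integral>\<^sup>+y. ennreal (norm (F y)) \<partial>\<mu>)"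
      using nn_integral_uminus[of "\<lambda>y. ennreal (exp (- log_scale y)) * ennreal (norm (F y))"]
      by (simp flip: mult.assoc ennreal_mult exp_add)
    also have "\<dots> * (\<integral>\<^sup>+x. ennreal ((tent (shift x))\<^sup>2 * \<bar>p (log_scale x)\<bar>) \<partial>\<mu>) < \<infinity>"
      using F nn_integral_tent_profile[OF p] by (simp add: integrable_iff_bounded ennreal_mult_less_top)
    finally show "(\<integral>\<^sup>+w. ennreal (norm (?K w)) \<partial>(\<mu> \<Otimes>\<^sub>M \<mu>)) < \<infinity>" .
  qed
  show "integrable \<mu> (\<lambda>x. tent (shift x) *\<^sub>R ruc_at 0 (twisted_conv \<mu> (strip_kernel p) c x))"
    unfolding conv using P.integrable_fst'[OF int] by simp
  have "strip_functional (twisted_conv \<mu> (strip_kernel p) c) = (\<integral>x. (\<integral>y. K x (- y) \<partial>\<mu>) \<partial>\<mu>)"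
    unfolding strip_functional_def conv ..
  also have "\<dots> = (\<integral>y. (\<integral>x. K x (- y) \<partial>\<mu>) \<partial>\<mu>)"
    using P.Fubini_integral[OF int] by simp
  also have "\<dots> = (\<integral>y. strip_mean p *\<^sub>R (exp (log_scale y) *\<^sub>R F (- y)) \<partial>\<mu>)"
  proof (intro Bochner_Integration.integral_cong refl)
    fix y
    have "(\<integral>x. K x (- y) \<partial>\<mu>) = strip_mean (\<lambda>s. p (s + log_scale y)) *\<^sub>R F (- y)"
      using integrable_mean[OF profile_shift[OF p], of "log_scale y"]
      by (simp add: K_def strip_mean_def)
    then show "(\<integral>x. K x (- y) \<partial>\<mu>) = strip_mean p *\<^sub>R (exp (log_scale y) *\<^sub>R F (- y))"
      by (simp add: strip_mean_shift mult.commute)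
  qed
  also have "\<dots> = strip_mean p *\<^sub>R (\<integral>y. exp (log_scale y) *\<^sub>R F (- y) \<partial>\<mu>)"
    by (rule integral_scaleR_right)
  also have "(\<integral>y. exp (log_scale y) *\<^sub>R F (- y) \<partial>\<mu>) = (\<integral>y. F y \<partial>\<mu>)"
    using integral_uminus[of "\<lambda>y. exp (- log_scale y) *\<^sub>R F y"] by (simp flip: exp_add)
  finally show "strip_functional (twisted_conv \<mu> (strip_kernel p) c) = strip_mean p * strip_functional c"
    by (simp add: strip_functional_def F_def scaleR_conv_of_real)
qed

section \<open>The subalgebra of strip kernels\<close>

lemma twisted_star_strip_kernel:
  "twisted_star \<mu> (strip_kernel p) x = strip_kernel (profile_star p) x"
proof (rule ruc_eqI)
  fix z
  have "- x + (x + z) = z"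
    by (simp flip: add.assoc)
  then show "ruc_at z (twisted_star \<mu> (strip_kernel p) x) = ruc_at z (strip_kernel (profile_star p) x)"
    by (simp add: twisted_star_def modular_function_haar ruc_at_strip_kernel profile_star_def
        scaleR_conv_of_real)
qed

lemma twisted_star_cong_AE:
  assumes "AE x in \<mu>. h x = h' x"
  shows "AE x in \<mu>. twisted_star \<mu> h x = twisted_star \<mu> h' x"
  using AE_uminus[OF assms] by eventually_elim (simp add: twisted_star_def)

definition profile_conv :: "(real \<Rightarrow> real) \<Rightarrow> (real \<Rightarrow> real) \<Rightarrow> real \<Rightarrow> real" where
  "profile_conv q p s =
    (\<integral>y. exp (log_scale y) * (q (s - log_scale y) * p (log_scale y) * (tent (shift y))\<^sup>2) \<partial>\<mu>)"

lemma profile_profile_conv: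
  assumes "profile q" "profile p"
  shows "profile (profile_conv q p)"
proof -
  obtain Q where Q: "0 \<le> Q" "\<And>s. \<bar>q s\<bar> \<le> Q" "\<And>s. q s \<noteq> 0 \<Longrightarrow> \<bar>s\<bar> \<le> Q"
    using profile_bound[OF assms(1)] by blast
  obtain R where R: "0 \<le> R" "\<And>s. \<bar>p s\<bar> \<le> R" "\<And>s. p s \<noteq> 0 \<Longrightarrow> \<bar>s\<bar> \<le> R"
    using profile_bound[OF assms(2)] by blast
  note [measurable] = profile_measurable[OF assms(1)] profile_measurable[OF assms(2)]
  let ?g = "\<lambda>s y. exp (log_scale y) * (q (s - log_scale y) * p (log_scale y) * (tent (shift y))\<^sup>2)"
  let ?B = "(exp R * (Q * R)) * measure \<mu> (box_set (max R 1))"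
  have int: "integrable \<mu> (\<lambda>y. exp R * (Q * R) * indicator (box_set (max R 1)) y)"
    using emeasure_box_less_top[of "max R 1"]
    by (intro integrable_mult_right integrable_real_indicator) auto
  have le: "\<bar>?g s y\<bar> \<le> exp R * (Q * R) * indicator (box_set (max R 1)) y" for s y
  proof (cases "tent (shift y) = 0 \<or> p (log_scale y) = 0")
    case True
    with Q(1) R(1) show ?thesis by auto
  next
    case False
    then have y: "\<bar>log_scale y\<bar> \<le> R" "\<not> 1 \<le> \<bar>shift y\<bar>"
      using R(3)[of "log_scale y"] tent_eq_0[of "shift y"] by blast+
    then have "y \<in> box_set (max R 1)"
      by (auto simp: box_set_def)
    moreover have "exp (log_scale y) * (\<bar>q (s - log_scale y)\<bar> * \<bar>p (log_scale y)\<bar> * (tent (shift y))\<^sup>2) \<le>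
        exp R * (Q * R * 1)"
      using y Q(1) R(1) by (intro mult_mono power_le_one tent_bounds Q(2) R(2) mult_nonneg_nonneg) auto
    ultimately show ?thesis by (simp add: abs_mult)
  qed
  have "\<bar>profile_conv q p s\<bar> \<le> ?B" for s
  proof -
    have "integrable \<mu> (?g s)"
    proof (rule Bochner_Integration.integrable_bound[OF int])
      show "AE y in \<mu>. norm (?g s y) \<le> norm (exp R * (Q * R) * indicator (box_set (max R 1)) y)"
        unfolding real_norm_def by (intro AE_I2 order_trans[OF le abs_ge_self])
    qed measurable
    then have "(\<integral>y. \<bar>?g s y\<bar> \<partial>\<mu>) \<le> (\<integral>y. exp R * (Q * R) * indicator (box_set (max R 1)) y \<partial>\<mu>)"
      by (intro Bochner_Integration.integral_mono int le integrable_abs)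
    then have "\<bar>profile_conv q p s\<bar> \<le> (\<integral>y. exp R * (Q * R) * indicator (box_set (max R 1)) y \<partial>\<mu>)"
      using integral_abs_bound[of \<mu> "?g s"] unfolding profile_conv_def by linarith
    then show ?thesis by simp
  qed
  moreover have "\<bar>s\<bar> \<le> Q + R" if "profile_conv q p s \<noteq> 0" for s
  proof (rule ccontr)
    assume s: "\<not> \<bar>s\<bar> \<le> Q + R"
    have "?g s y = 0" for y
      using Q(3)[of "s - log_scale y"] R(3)[of "log_scale y"] s by fastforce
    then have "profile_conv q p s = 0"
      unfolding profile_conv_def by (simp only: Bochner_Integration.integral_zero)
    with that show False ..
  qed
  moreover have "profile_conv q p \<in> borel_measurable borel"
    unfolding profile_conv_def[abs_def] by measurable
  ultimately show ?thesis
    unfolding profile_def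
    by (intro conjI exI[of _ "max ?B (Q + R)"]) (auto simp: le_max_iff_disj)
qed

text \<open>
  The integral over the shift of \<open>y\<close> does not depend on the point of evaluation, so that the
  product is again a strip kernel.
\<close>

lemma twisted_conv_strip_kernels:
  assumes "profile q" "profile p"
  shows "twisted_conv \<mu> (strip_kernel q) (strip_kernel p) x = strip_kernel (profile_conv q p) x"
proof (rule ruc_eqI)
  fix z
  note [measurable] = profile_measurable[OF assms(1)] profile_measurable[OF assms(2)]
  let ?h = "\<lambda>z y. q (log_scale x + log_scale y) * p (- log_scale y) * (tent (shift (- y + z)))\<^sup>2"
  have z: "z = aff 0 (shift z) + aff (log_scale z) 0"
    by (simp add: affine_plus)
  \<comment> \<open>Translating y by the shift of z makes the integral independent of z, because the remaining
    factor of z is a dilation, which does not change the shift of - y.\<close>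
  have "(\<integral>y. ?h z y \<partial>\<mu>) = (\<integral>y. ?h z (aff 0 (shift z) + y) \<partial>\<mu>)"
    by (rule integral_left[symmetric]) measurable
  also have "\<dots> = (\<integral>y. ?h 0 y \<partial>\<mu>)"
  proof -
    have "- (aff 0 (shift z) + y) + z = - y + aff (log_scale z) 0" for y
      by (subst (2) z) (simp add: minus_add add.assoc[symmetric] del: affine_plus)
    then show ?thesis
      by (simp add: shift_simps)
  qed
  also have "\<dots> = profile_conv q p (log_scale x)"
    using integral_uminus[of "\<lambda>y. q (log_scale x - log_scale y) * p (log_scale y) * (tent (shift y))\<^sup>2"]
    by (simp add: profile_conv_def)
  finally have conv: "(\<integral>y. ?h z y \<partial>\<mu>) = profile_conv q p (log_scale x)" .
  have "ruc_at z (twisted_conv \<mu> (strip_kernel q) (strip_kernel p) x) = tent (shift (x + z)) *\<^sub>R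
      (\<integral>y. complex_of_real (tent (shift z) * ?h z y) \<partial>\<mu>)"
    unfolding ruc_at_twisted_conv_strip_kernel[OF assms(1) strongly_measurable_strip_kernel[OF assms(2)]
        norm_strip_kernel_integrable[OF assms(2)]] ruc_at_strip_kernel
    by (simp add: scaleR_conv_of_real power2_eq_square mult_ac)
  also have "\<dots> = tent (shift (x + z)) *\<^sub>R complex_of_real (tent (shift z) * profile_conv q p (log_scale x))"
    by (simp only: integral_complex_of_real integral_mult_right_zero conv)
  finally show "ruc_at z (twisted_conv \<mu> (strip_kernel q) (strip_kernel p) x) =
      ruc_at z (strip_kernel (profile_conv q p) x)"
    by (simp add: ruc_at_strip_kernel scaleR_conv_of_real)
qed

text \<open>
  Both sides are the value of the functional at a product of two strip kernels.
\<close>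

lemma strip_mean_profile_conv:
  assumes "profile q" "profile p"
  shows "strip_mean (profile_conv q p) = strip_mean q * strip_mean p"
proof -
  have "twisted_conv \<mu> (strip_kernel q) (strip_kernel p) = strip_kernel (profile_conv q p)"
    using twisted_conv_strip_kernels[OF assms] by blast
  then have "complex_of_real (strip_mean (profile_conv q p)) = complex_of_real (strip_mean q) * complex_of_real (strip_mean p)"
    using strip_functional_conv(2)[OF assms(1) strongly_measurable_strip_kernel[OF assms(2)]
        norm_strip_kernel_integrable[OF assms(2)]]
    by (simp only: strip_functional_strip_kernel)
  then show ?thesis
    by (simp only: of_real_mult[symmetric] of_real_eq_iff)
qed

lemma strip_mean_pos:
  assumes p: "profile p" "\<And>s. 0 \<le> p s" and ab: "a < b" "\<And>s. a < s \<Longrightarrow> s < b \<Longrightarrow> 0 < p s"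
  shows "0 < strip_mean p"
proof -
  have [measurable]: "p \<in> borel_measurable borel"
    using p(1) by (rule profile_measurable)
  have "strip_mean p \<noteq> 0"
  proof
    assume "strip_mean p = 0"
    then have "AE x in \<mu>. (tent (shift x))\<^sup>2 * p (log_scale x) = 0"
      unfolding strip_mean_def
      by (subst (asm) integral_nonneg_eq_0_iff_AE[OF integrable_mean[OF p(1)]]) (auto simp: p(2))
    then have "emeasure \<mu> {x. (tent (shift x))\<^sup>2 * p (log_scale x) \<noteq> 0} = 0"
      by (subst (asm) AE_iff_measurable[OF _ refl]) auto
    moreover have "0 < emeasure \<mu> {x. (tent (shift x))\<^sup>2 * p (log_scale x) \<noteq> 0}"
    proof (rule emeasure_pos[OF _ ab(1), of _ "- 1" 1])
      fix s t :: real
      assume "a < s" "s < b" "-1 < t" "t < 1"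
      then show "aff s t \<in> {x. (tent (shift x))\<^sup>2 * p (log_scale x) \<noteq> 0}"
        using ab(2)[of s] by (auto simp: tent_def max_def)
    qed auto
    ultimately show False by simp
  qed
  moreover have "0 \<le> strip_mean p"
    unfolding strip_mean_def by (intro Bochner_Integration.integral_nonneg) (simp add: p(2))
  ultimately show ?thesis by simp
qed

lemma strip_mean_diff:
  assumes "profile p" "profile q"
  shows "strip_mean (\<lambda>s. p s - c * q s) = strip_mean p - c * strip_mean q"
proof -
  have "strip_mean (\<lambda>s. p s - c * q s) = (\<integral>x. (tent (shift x))\<^sup>2 * p (log_scale x) -
      c * ((tent (shift x))\<^sup>2 * q (log_scale x)) \<partial>\<mu>)"
    unfolding strip_mean_def by (simp add: algebra_simps)
  then show ?thesis
    using integrable_mean[OF assms(1)] integrable_mean[OF assms(2)]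
    by (simp add: strip_mean_def)
qed

text \<open>
  The means of the indicator functions of \<open>{-1<..0}\<close> and \<open>{0<..1}\<close> have ratio \<open>exp 1\<close>, and those of
  their adjoints are equal. The signs therefore are those of \<open>exp 1 - 2\<close> and \<open>1 - 2\<close>.
\<close>

lemma strip_mean_step: "0 < strip_mean step" "strip_mean (profile_star step) < 0"
proof -
  let ?u = "indicator {0<..1} :: real \<Rightarrow> real" and ?v = "indicator {-1<..0} :: real \<Rightarrow> real"
  have uv: "profile ?u" "profile ?v"
    by (auto intro!: profile_indicator[of _ 1])
  have "?v = (\<lambda>s. ?u (s + 1))"
    by (auto simp: indicator_def fun_eq_iff)
  then have v: "strip_mean ?v = exp 1 * strip_mean ?u"
    using strip_mean_shift[of ?u 1] by simp
  have "strip_mean step = strip_mean ?v - 2 * strip_mean ?u"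
    unfolding step_def[abs_def] by (rule strip_mean_diff[OF uv(2,1)])
  also have "\<dots> = (exp 1 - 2) * strip_mean ?u"
    by (simp add: v algebra_simps)
  also have "0 < \<dots>"
  proof (rule mult_pos_pos)
    show "0 < exp 1 - (2::real)"
      using exp_lower_Taylor_quadratic[of "1::real"] by simp
    show "0 < strip_mean ?u"
      using uv(1) by (rule strip_mean_pos[of _ 0 1]) auto
  qed
  finally show "0 < strip_mean step" .
  let ?u' = "profile_star ?u" and ?v' = "profile_star ?v"
  have uv': "profile ?u'" "profile ?v'"
    using uv by (simp_all add: profile_profile_star)
  have "(\<lambda>s. ?v' (s + 1)) = (\<lambda>s. exp 1 * ?u' s)"
    by (auto simp: indicator_def profile_star_def fun_eq_iff exp_add)
  then have "exp 1 * strip_mean ?v' = exp 1 * strip_mean ?u'"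
    using strip_mean_shift[OF profile_measurable[OF uv'(2)], of 1] by (simp add: strip_mean_def mult.left_commute)
  then have eq: "strip_mean ?v' = strip_mean ?u'" by simp
  have "profile_star step = (\<lambda>s. ?v' s - 2 * ?u' s)"
    by (simp add: profile_star_def step_def fun_eq_iff algebra_simps)
  then have "strip_mean (profile_star step) = - strip_mean ?u'"
    using strip_mean_diff[OF uv'(2,1), of 2] eq by simp
  moreover have "0 < strip_mean ?u'"
    using uv'(1) by (rule strip_mean_pos[of _ "- 1" 0]) (auto simp: profile_star_def)
  ultimately show "strip_mean (profile_star step) < 0" by simp
qed

lemma AE_log_scale_neq: "AE x in \<mu>. log_scale x \<noteq> a"
proof -
  obtain k where k: "\<And>f. f \<in> borel_measurable borel \<Longrightarrow>
      (\<integral>\<^sup>+x. f x \<partial>\<mu>) = ennreal k * (\<integral>\<^sup>+x. f x \<partial>affine_measure)"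
    using haar_unique by blast
  let ?A = "{x. log_scale x = a}"
  have [measurable]: "?A \<in> sets borel" by measurable
  have "emeasure affine_measure ?A =
      (\<integral>\<^sup>+s. ennreal (exp (- s)) * (\<integral>\<^sup>+t. indicator ?A (aff s t) \<partial>lborel) \<partial>lborel)"
    by (rule emeasure_affine_measure) measurable
  also have "\<dots> = (\<integral>\<^sup>+s. 0 \<partial>(lborel :: real measure))"
  proof (rule nn_integral_cong_AE)
    show "AE s in lborel. ennreal (exp (- s)) * (\<integral>\<^sup>+t. indicator ?A (aff s t) \<partial>lborel) = 0"
      using AE_lborel_singleton[of a] by eventually_elim (simp add: indicator_def)
  qed
  finally have "emeasure \<mu> ?A = 0"
    using k[of "indicator ?A"] by simp
  then show ?thesis
    by (subst AE_iff_measurable[OF _ refl]) auto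
qed

abbreviation L1 where "L1 \<equiv> twisted_L1 \<mu>"

abbreviation cls where "cls \<equiv> ae_class \<mu>"

lemma sa_add_cls: "sa_add L1 (cls f) (cls g) = cls (\<lambda>x. f x + g x)"
proof -
  have "AE x in \<mu>. representative (cls f) x + representative (cls g) x = f x + g x"
    using AE_representative[of \<mu> f] AE_representative[of \<mu> g] by eventually_elim simp
  then show ?thesis by (simp add: twisted_L1_def ae_class_eq_iff)
qed

lemma sa_scale_cls: "sa_scale L1 c (cls f) = cls (\<lambda>x. cscale_ruc c (f x))"
proof -
  have "AE x in \<mu>. cscale_ruc c (representative (cls f) x) = cscale_ruc c (f x)"
    using AE_representative[of \<mu> f] by eventually_elim simp
  then show ?thesis by (simp add: twisted_L1_def ae_class_eq_iff)
qed

lemma sa_mult_cls: "sa_mult L1 (cls f) (cls g) = cls (twisted_conv \<mu> f g)"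
  using twisted_conv_cong_AE[OF AE_representative[of \<mu> f] AE_representative[of \<mu> g]]
  by (simp add: twisted_L1_def ae_class_eq_iff)

lemma sa_star_cls: "sa_star L1 (cls f) = cls (twisted_star \<mu> f)"
  using twisted_star_cong_AE[OF AE_representative[of \<mu> f]]
  by (simp add: twisted_L1_def ae_class_eq_iff)

lemma sa_zero_cls: "sa_zero L1 = cls (\<lambda>x. 0)"
  by (simp add: twisted_L1_def)

lemma cls_strip_kernel_carrier: "profile p \<Longrightarrow> cls (strip_kernel p) \<in> sa_carrier L1"
  by (simp add: twisted_L1_def strongly_integrable_strip_kernel)

lemma twisted_conv_zero: "twisted_conv \<mu> (\<lambda>x. 0) f x = 0" "twisted_conv \<mu> f (\<lambda>x. 0) x = 0"
  by (simp_all add: twisted_conv_def strong_integral_zero)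


section \<open>Absence of an identity and the identity of the unitization\<close>

text \<open>
  Take the profiles that are \<open>1\<close> on a shrinking neighbourhood of \<open>0\<close>. If \<open>e\<close> were an identity,
  then multiplying their strip kernels by \<open>e\<close> and evaluating at \<open>0\<close> would bound \<open>1\<close> by
  multiples of the integrals of \<open>norm (e y)\<close> over sets shrinking to the null set
  \<open>{y. log_scale y = 0}\<close>.
\<close>

lemma no_identity: "\<not> is_sa_identity L1 e"
proof
  assume e: "is_sa_identity L1 e"
  then have "e \<in> sa_carrier L1" by (simp add: is_sa_identity_def)
  then obtain f where f: "e = cls f" "strongly_measurable \<mu> f"
      "(\<integral>\<^sup>+x. ennreal (norm (f x)) \<partial>\<mu>) < \<infinity>"
    by (rule sa_carrier_twisted_L1E)
  note [measurable] = borel_measurable_norm_strongly[OF f(2)]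
  \<comment> \<open>The profiles are the indicator functions of the intervals of radius d n. For x in the support,
    p (log_scale x + log_scale y) forces the scale of y into the interval of twice that radius, on
    which the modular factor exp (log_scale y) of the inversion is at most exp 2.\<close>
  define d where "d n = inverse (real (Suc n))" for n
  define u :: "nat \<Rightarrow> real \<Rightarrow> real" where
    "u n s = exp 2 * indicator {-2 * d n<..<2 * d n} s" for n s
  have [measurable]: "u n \<in> borel_measurable borel" for n
    unfolding u_def by measurable
  have d: "0 < d n" "d n \<le> 1" for n
    by (auto simp: d_def field_simps)
  have "1 \<le> (\<integral>\<^sup>+y. ennreal (u n (log_scale y) * norm (f y)) \<partial>\<mu>)" for n
  proof -
    let ?p = "indicator {- d n<..<d n} :: real \<Rightarrow> real"
    have p: "profile ?p"
      using d[of n] by (intro profile_indicator[of _ 1]) auto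
    have "sa_mult L1 (cls (strip_kernel ?p)) e = cls (strip_kernel ?p)"
      using e cls_strip_kernel_carrier[OF p] by (simp add: is_sa_identity_def)
    then have ae: "AE x in \<mu>. twisted_conv \<mu> (strip_kernel ?p) f x = strip_kernel ?p x"
      by (simp add: f(1) sa_mult_cls ae_class_eq_iff)
    let ?A = "{x. \<bar>log_scale x\<bar> < d n \<and> \<bar>shift x\<bar> < 1}"
    have [measurable]: "?A \<in> sets borel" by measurable
    have "0 < emeasure \<mu> ?A"
      using d[of n] by (intro emeasure_pos[of _ "- d n" "d n" "- 1" 1]) auto
    then have "\<not> (AE x in \<mu>. x \<notin> ?A)"
      by (subst AE_iff_measurable[OF _ refl]) auto
    then obtain x where x: "x \<in> ?A" "twisted_conv \<mu> (strip_kernel ?p) f x = strip_kernel ?p x"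
      using ae by (meson eventually_mono)
    let ?I = "\<integral>y. (?p (log_scale x + log_scale y) * tent (shift (- y + 0))) *\<^sub>R ruc_at 0 (f (- y)) \<partial>\<mu>"
    have "tent (shift x) *\<^sub>R ?I = ruc_at 0 (strip_kernel ?p x)"
      using ruc_at_twisted_conv_strip_kernel[OF p f(2,3), of 0 x] x(2) by simp
    also have "\<dots> = tent (shift x) *\<^sub>R 1"
      using x(1) by (simp add: ruc_at_strip_kernel abs_less_iff shift_simps tent_def scaleR_conv_of_real)
    finally have I: "?I = 1"
      using x(1) by (simp add: tent_def)
    have "1 = ennreal (norm ?I)"
      unfolding I by simp
    also have "\<dots> \<le> (\<integral>\<^sup>+y. ennreal (norm ((?p (log_scale x + log_scale y) * tent (shift (- y + 0))) *\<^sub>R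
        ruc_at 0 (f (- y)))) \<partial>\<mu>)"
      by (rule norm_integral_le_nn_integral)
    also have "\<dots> \<le> (\<integral>\<^sup>+y. ennreal (indicator {-2 * d n<..<2 * d n} (log_scale (- y)) * norm (f (- y))) \<partial>\<mu>)"
    proof (intro nn_integral_mono ennreal_leI)
      fix y
      have "?p (log_scale x + log_scale y) * tent (shift (- y + 0)) \<le>
          indicator {-2 * d n<..<2 * d n} (log_scale (- y)) * 1"
        using x(1) by (intro mult_mono tent_bounds) (auto simp: indicator_def abs_less_iff)
      then show "norm ((?p (log_scale x + log_scale y) * tent (shift (- y + 0))) *\<^sub>R ruc_at 0 (f (- y))) \<le>
          indicator {-2 * d n<..<2 * d n} (log_scale (- y)) * norm (f (- y))"
        by (simp only: norm_scaleR mult_1_right)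
          (intro mult_mono norm_ruc_at_le, auto simp: tent_bounds)
    qed
    also have "\<dots> = (\<integral>\<^sup>+y. ennreal (exp (log_scale y)) *
        ennreal (indicator {-2 * d n<..<2 * d n} (log_scale y) * norm (f y)) \<partial>\<mu>)"
      by (rule nn_integral_uminus) measurable
    also have "\<dots> \<le> (\<integral>\<^sup>+y. ennreal (u n (log_scale y) * norm (f y)) \<partial>\<mu>)"
      using d(2)[of n] by (intro nn_integral_mono)
        (auto simp: u_def indicator_def intro!: mult_right_mono simp flip: ennreal_mult)
    finally show ?thesis .
  qed
  moreover have "(\<lambda>n. \<integral>\<^sup>+y. ennreal (u n (log_scale y) * norm (f y)) \<partial>\<mu>) \<longlonglongrightarrow> (\<integral>\<^sup>+y. 0 \<partial>\<mu>)"
  proof (rule nn_integral_dominated_convergence[where w = "\<lambda>y. ennreal (exp 2 * norm (f y))"])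
    show "AE y in \<mu>. (\<lambda>n. ennreal (u n (log_scale y) * norm (f y))) \<longlonglongrightarrow> 0"
      using AE_log_scale_neq[of 0]
    proof eventually_elim
      case (elim y)
      have "(\<lambda>n. 2 * d n) \<longlonglongrightarrow> 2 * 0"
        unfolding d_def by (intro tendsto_mult tendsto_const LIMSEQ_inverse_real_of_nat)
      then have "\<forall>\<^sub>F n in sequentially. 2 * d n < \<bar>log_scale y\<bar>"
        by (rule order_tendstoD(2)) (use elim in simp)
      then have "\<forall>\<^sub>F n in sequentially. 0 = ennreal (u n (log_scale y) * norm (f y))"
        by eventually_elim (auto simp: u_def indicator_def)
      then show ?case
        by (rule Lim_transform_eventually[OF tendsto_const])
    qed
    show "(\<integral>\<^sup>+y. ennreal (exp 2 * norm (f y)) \<partial>\<mu>) < \<infinity>"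
      using f(3) by (simp add: ennreal_mult nn_integral_cmult ennreal_mult_less_top)
    show "AE y in \<mu>. ennreal (u n (log_scale y) * norm (f y)) \<le> ennreal (exp 2 * norm (f y))" for n
      by (intro AE_I2 ennreal_leI mult_right_mono) (auto simp: u_def indicator_def)
  qed measurable
  ultimately have "(1::ennreal) \<le> (\<integral>\<^sup>+y. 0 \<partial>\<mu>)"
    by (intro LIMSEQ_le_const[where X = "\<lambda>n. \<integral>\<^sup>+y. ennreal (u n (log_scale y) * norm (f y)) \<partial>\<mu>"]) auto
  then show False by simp
qed

lemma sa_identity_unitization: "sa_identity (unitization L1) = (1, sa_zero L1)"
  unfolding sa_identity_def
proof (rule the_equality)
  have carrier: "cls (\<lambda>x. 0) \<in> sa_carrier L1"
    using cls_strip_kernel_carrier[of "\<lambda>s. 0"] by (auto simp: profile_def strip_kernel_def[abs_def])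
  show id: "is_sa_identity (unitization L1) (1, sa_zero L1)"
    unfolding is_sa_identity_def
  proof (intro conjI ballI)
    fix b assume "b \<in> sa_carrier (unitization L1)"
    then obtain l f where "b = (l, cls f)"
      by (auto simp: unitization_def elim: sa_carrier_twisted_L1E)
    then show "sa_mult (unitization L1) (1, sa_zero L1) b = b"
        "sa_mult (unitization L1) b (1, sa_zero L1) = b"
      by (simp_all add: unitization_def sa_zero_cls sa_add_cls sa_scale_cls sa_mult_cls
          twisted_conv_zero[abs_def])
  qed (simp add: unitization_def sa_zero_cls carrier)
  show "e = (1, sa_zero L1)" if "is_sa_identity (unitization L1) e" for e
    using that id unfolding is_sa_identity_def by metis
qed


section \<open>A negative number in the spectrum\<close>

text \<open>
  An inverse \<open>(k, c)\<close> of \<open>strip_kernel p - strip_mean p\<close> in the unitization would satisfy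
  \<open>- strip_mean p * c + k * strip_kernel p + strip_kernel p \<star> c = 0\<close>. The functional
  takes opposite values on the first and on the third term, so that \<open>k * strip_mean p = 0\<close>; but the
  scalar part of the inverse requires \<open>- strip_mean p * k = 1\<close>.
\<close>

lemma strip_mean_in_spectrum:
  assumes p: "profile p"
  shows "complex_of_real (strip_mean p) \<in> spectrum L1 (cls (strip_kernel p))"
proof (rule ccontr)
  let ?l = "complex_of_real (strip_mean p)"
  assume "\<not> ?thesis"
  then have "sa_invertible (unitization L1) (sa_add (unitization L1) (0, cls (strip_kernel p))
      (sa_scale (unitization L1) (- ?l) (1, sa_zero L1)))"
    by (simp add: spectrum_def no_identity unital_spectrum_def sa_identity_unitization)
  then obtain w where w: "w \<in> sa_carrier (unitization L1)"
    "sa_mult (unitization L1) (sa_add (unitization L1) (0, cls (strip_kernel p))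
      (sa_scale (unitization L1) (- ?l) (1, sa_zero L1))) w = (1, sa_zero L1)"
    unfolding sa_invertible_def sa_identity_unitization by blast
  obtain k F where F: "w = (k, F)" "F \<in> sa_carrier L1"
    using w(1) by (auto simp: unitization_def)
  obtain c where c: "F = cls c" "strongly_measurable \<mu> c" "(\<integral>\<^sup>+x. ennreal (norm (c x)) \<partial>\<mu>) < \<infinity>"
    using F(2) by (rule sa_carrier_twisted_L1E)
  have k: "- ?l * k = 1"
    and "cls (\<lambda>x. cscale_ruc (- ?l) (c x) + cscale_ruc k (strip_kernel p x) +
      twisted_conv \<mu> (strip_kernel p) c x) = cls (\<lambda>x. 0)"
    using w(2) by (simp_all add: F(1) c(1) unitization_def sa_zero_cls sa_add_cls sa_scale_cls sa_mult_cls)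
  then have "AE x in \<mu>. cscale_ruc (- ?l) (c x) + cscale_ruc k (strip_kernel p x) +
      twisted_conv \<mu> (strip_kernel p) c x = 0"
    by (simp only: ae_class_eq_iff)
  then have ae: "AE x in \<mu>. - ?l * (tent (shift x) *\<^sub>R ruc_at 0 (c x)) +
      k * (tent (shift x) *\<^sub>R ruc_at 0 (strip_kernel p x)) +
      tent (shift x) *\<^sub>R ruc_at 0 (twisted_conv \<mu> (strip_kernel p) c x) = 0"
  proof eventually_elim
    case (elim x)
    have "tent (shift x) *\<^sub>R ruc_at 0 (cscale_ruc (- ?l) (c x) + cscale_ruc k (strip_kernel p x) +
        twisted_conv \<mu> (strip_kernel p) c x) = 0"
      unfolding elim by simp
    then show ?case
      by (simp add: scaleR_conv_of_real algebra_simps)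
  qed
  note ints = integrable_strip_functional[OF c(2,3)]
    integrable_strip_functional[OF strongly_measurable_strip_kernel[OF p] norm_strip_kernel_integrable[OF p]]
    strip_functional_conv(1)[OF p c(2,3)]
  have "- ?l * strip_functional c + k * strip_functional (strip_kernel p) +
      strip_functional (twisted_conv \<mu> (strip_kernel p) c) =
    (\<integral>x. - ?l * (tent (shift x) *\<^sub>R ruc_at 0 (c x)) +
      k * (tent (shift x) *\<^sub>R ruc_at 0 (strip_kernel p x)) +
      tent (shift x) *\<^sub>R ruc_at 0 (twisted_conv \<mu> (strip_kernel p) c x) \<partial>\<mu>)"
    unfolding strip_functional_def
    using ints by (simp only: Bochner_Integration.integral_add integrable_mult_right
        integral_mult_right_zero Bochner_Integration.integrable_add)
  also have "\<dots> = 0"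
    by (rule integral_eq_zero_AE[OF ae])
  finally have "k * ?l = 0"
    by (simp add: strip_functional_conv(2)[OF p c(2,3)] strip_functional_strip_kernel)
  with k show False by (simp add: mult.commute)
qed

lemma not_symmetric: "\<not> symmetric_star_algebra L1"
proof
  assume sym: "symmetric_star_algebra L1"
  let ?q = "profile_conv (profile_star step) step"
  note q = profile_profile_star[OF profile_step] profile_step
  have "twisted_star \<mu> (strip_kernel step) = strip_kernel (profile_star step)"
    by (rule ext) (rule twisted_star_strip_kernel)
  moreover have "twisted_conv \<mu> (strip_kernel (profile_star step)) (strip_kernel step) = strip_kernel ?q"
    by (rule ext) (rule twisted_conv_strip_kernels[OF q])
  ultimately have "sa_mult L1 (sa_star L1 (cls (strip_kernel step))) (cls (strip_kernel step)) =
      cls (strip_kernel ?q)"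
    by (simp add: sa_star_cls sa_mult_cls)
  then have "spectrum L1 (cls (strip_kernel ?q)) \<subseteq> complex_of_real ` {0..}"
    using sym cls_strip_kernel_carrier[OF profile_step] unfolding symmetric_star_algebra_def by metis
  moreover have neg: "strip_mean ?q < 0"
    unfolding strip_mean_profile_conv[OF q] using strip_mean_step by (rule mult_neg_pos[rotated])
  ultimately have "complex_of_real (strip_mean ?q) \<in> complex_of_real ` {0..}"
    using strip_mean_in_spectrum[OF profile_profile_conv[OF q]] by auto
  with neg show False by auto
qed

end

theorem theorem5p1:
  fixes \<mu> :: "affine_group measure"
  assumes "left_haar_measure \<mu>"
  shows "\<not> symmetric_star_algebra (twisted_L1 \<mu>)"
proof -
  interpret affine_haar \<mu> by standard fact
  show ?thesis by (rule not_symmetric)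
qed

end
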